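(* Let $p$ be a prime with $p\equiv1\pmod 4$, and let $q=p_{*}^{t}$ ($t\geq1$) be a power of a prime $p_{*}$ with $p\nmid p_{*}$. If $q$ is a quadratic residue modulo $p$, then there exists an asymmetric quantum code $[[tp,\ t,\ d_z/d_x]]_{p_{*}}$ with $d_z\geq\sqrt{p}$ and $d_x\geq\sqrt{p}$.
   Context: An AQECC $[[n,k,d_z/d_x]]_{r}$ over a prime power alphabet size $r$ is an $r^k$-dimensional subspace of $\mathbb{C}^{r^n}$ correcting all qudit-flip errors up to $\lfloor (d_x-1)/2\rfloor$ and all phase-shift errors up to $\lfloor (d_z-1)/2\rfloor$. *)

theory Defs
  imports "HOL-Analysis.Analysis" "HOL-Number_Theory.Number_Theory"
begin

text \<open>Computational basis of (C^r)^{\<otimes> n}: strings x over {0..<r} of length n,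
  encoded as functions nat => nat vanishing from position n on.
  A state vector of C^(r^n) is a function from such strings to complex numbers
  (values outside the basis set are irrelevant).
  The alphabet is Z_r; we only use it for r prime, where Z_r = F_r.\<close>

definition qbasis :: "nat \<Rightarrow> nat \<Rightarrow> (nat \<Rightarrow> nat) set" where
  "qbasis n r = {x. (\<forall>i<n. x i < r) \<and> (\<forall>i\<ge>n. x i = 0)}"

definition qinner :: "nat \<Rightarrow> nat \<Rightarrow> ((nat \<Rightarrow> nat) \<Rightarrow> complex) \<Rightarrow> ((nat \<Rightarrow> nat) \<Rightarrow> complex) \<Rightarrow> complex" where
  "qinner n r u v = (\<Sum>x\<in>qbasis n r. cnj (u x) * v x)"

definition qwt :: "nat \<Rightarrow> (nat \<Rightarrow> nat) \<Rightarrow> nat" where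
  "qwt n a = card {i. i < n \<and> a i \<noteq> 0}"

text \<open>Generalized Pauli operators: X(a)|x> = |x + a>, Z(b)|x> = omega^(b.x)|x>,
  omega = exp(2 pi i / r).\<close>
definition pauli_X :: "nat \<Rightarrow> (nat \<Rightarrow> nat) \<Rightarrow> ((nat \<Rightarrow> nat) \<Rightarrow> complex) \<Rightarrow> ((nat \<Rightarrow> nat) \<Rightarrow> complex)" where
  "pauli_X r a v = (\<lambda>x. v (\<lambda>i. (x i + r - a i) mod r))"

definition pauli_Z :: "nat \<Rightarrow> nat \<Rightarrow> (nat \<Rightarrow> nat) \<Rightarrow> ((nat \<Rightarrow> nat) \<Rightarrow> complex) \<Rightarrow> ((nat \<Rightarrow> nat) \<Rightarrow> complex)" where
  "pauli_Z n r b v = (\<lambda>x. cis (2 * pi * real (\<Sum>i<n. b i * x i) / real r) * v x)"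

text \<open>An [[n,k,dz/dx]]_r asymmetric quantum code: an r^k-dimensional subspace
  of C^(r^n) (given by an orthonormal basis psi_0..psi_{r^k-1}) which corrects the
  error set {X(a)Z(b) : wt(a) \<le> floor((dx-1)/2), wt(b) \<le> floor((dz-1)/2)},
  i.e. satisfies the Knill-Laflamme conditions
  <psi_i | E1^dagger E2 | psi_j> = c(E1,E2) delta_ij for all errors E1, E2.\<close>
definition is_AQECC :: "nat \<Rightarrow> nat \<Rightarrow> nat \<Rightarrow> nat \<Rightarrow> nat \<Rightarrow> bool" where
  "is_AQECC r n k dz dx \<longleftrightarrow>
     (\<exists>\<psi> :: nat \<Rightarrow> ((nat \<Rightarrow> nat) \<Rightarrow> complex).
        (\<forall>i<r^k. \<forall>j<r^k. qinner n r (\<psi> i) (\<psi> j) = (if i = j then 1 else 0)) \<and>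
        (\<forall>a b a' b'. a \<in> qbasis n r \<and> b \<in> qbasis n r \<and> a' \<in> qbasis n r \<and> b' \<in> qbasis n r \<and>
            qwt n a \<le> (dx - 1) div 2 \<and> qwt n a' \<le> (dx - 1) div 2 \<and>
            qwt n b \<le> (dz - 1) div 2 \<and> qwt n b' \<le> (dz - 1) div 2 \<longrightarrow>
          (\<exists>c. \<forall>i<r^k. \<forall>j<r^k.
             qinner n r (pauli_X r a (pauli_Z n r b (\<psi> i)))
                        (pauli_X r a' (pauli_Z n r b' (\<psi> j))) = (if i = j then c else 0))))"

end

theory Submission
  imports Defs
begin

text \<open>
  Write \<open>r\<close> for the prime alphabet size, \<open>m = (p - 1) / 4\<close>, and let \<open>E\<close> be convolution with the
  indicator function of the quadratic residues on functions on \<open>Z/p\<close>. On functions of sum zero,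
  \<open>E\<^sup>2 + E = m\<close>, so the quadratic residue codes are the eigenspaces of \<open>E\<close> for the two roots of
  \<open>y\<^sup>2 + y = m\<close>, and no root of unity is needed. Let \<open>M\<close> be an integer \<open>t \<times> t\<close> matrix with
  \<open>M\<^sup>2 + M = m\<close> modulo \<open>r\<close>, let \<open>C\<^sub>0\<close> be the space of \<open>t\<close>-tuples \<open>c\<close> of functions of sum zero with
  \<open>E c = M c\<close>, and let \<open>C\<^sub>1\<close> be \<open>C\<^sub>0\<close> plus the constant tuples. The quantum code is the CSS code
  of \<open>C\<^sub>0 \<subseteq> C\<^sub>1\<close>, which has dimension \<open>r\<^sup>t\<close>.

  The field with \<open>r\<^sup>t\<close> elements is not needed either. If \<open>t\<close> is odd, then \<open>r\<close> itself is a residue modulo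
  \<open>p\<close>, so by reciprocity \<open>y\<^sup>2 + y = m\<close> has a root \<open>a\<close> modulo \<open>r\<close>, and \<open>M = a I\<close> works. If \<open>t\<close> is even,
  \<open>M\<close> is made of \<open>2 \<times> 2\<close> companion blocks of \<open>y\<^sup>2 + y - m\<close>; the ring they generate is reduced because the
  discriminant \<open>p\<close> is a unit modulo \<open>r\<close>, which is all that the square root bound requires.

  The square root bound is the classical one: substituting \<open>x \<mapsto> n x\<close> for a nonresidue \<open>n\<close> carries an
  eigenvector to one for the conjugate eigenvalue, so the convolution of a codeword outside \<open>C\<^sub>0\<close> with
  its image is a nonzero constant, and its support, having a sumset that covers \<open>Z/p\<close>, has size at least
  \<open>\<surd>p\<close>. As \<open>-1\<close> is a residue, \<open>E\<close> is symmetric, so the dual code is of the same kind, for the conjugate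
  eigenvalue.
\<close>

section \<open>Legendre symbols\<close>

lemma Legendre_cong:
  assumes "[a = b] (mod p)"
  shows "Legendre a p = Legendre b p"
proof -
  have "[a = 0] (mod p) \<longleftrightarrow> [b = 0] (mod p)" "QuadRes p a \<longleftrightarrow> QuadRes p b"
    using assms by (auto simp: QuadRes_def cong_def)
  then show ?thesis by (simp add: Legendre_def)
qed

text \<open>Euler's criterion makes the two sides congruent modulo \<open>p\<close>. Both lie in
  {-1, 0, 1}, so they differ by at most 2, which is less than \<open>p\<close>.\<close>

lemma Legendre_mult:
  assumes "prime p" "2 < p"
  shows "Legendre (a * b) (int p) = Legendre a (int p) * Legendre b (int p)"
proof -
  have "[Legendre (a * b) (int p) = (a * b) ^ ((p - 1) div 2)] (mod int p)"
    using euler_criterion[OF assms] .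
  also have "(a * b) ^ ((p - 1) div 2) = a ^ ((p - 1) div 2) * b ^ ((p - 1) div 2)"
    by (simp add: power_mult_distrib)
  also have "[a ^ ((p - 1) div 2) * b ^ ((p - 1) div 2) = Legendre a (int p) * Legendre b (int p)] (mod int p)"
    using euler_criterion[OF assms, of a] euler_criterion[OF assms, of b] by (metis cong_mult cong_sym)
  finally have *: "int p dvd Legendre (a * b) (int p) - Legendre a (int p) * Legendre b (int p)"
    by (simp add: cong_iff_dvd_diff)
  have "Legendre x (int p) \<in> {-1, 0, 1}" for x
    by (simp add: Legendre_def)
  from this[of "a * b"] this[of a] this[of b]
  have "\<bar>Legendre (a * b) (int p) - Legendre a (int p) * Legendre b (int p)\<bar> < int p"
    using assms(2) by auto
  with * show ?thesis
    using zdvd_imp_le[of "int p" "\<bar>Legendre (a * b) (int p) - Legendre a (int p) * Legendre b (int p)\<bar>"] by force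
qed

text \<open>Gauss's lemma: the doubles of 1, ..., 2m stay below \<open>p\<close>, so they are
  already reduced, and they exceed \<open>(p - 1) / 2 = 2 * m\<close> exactly for the
  \<open>m\<close> values of x with m < x \<le> 2m.\<close>

lemma Legendre_2:
  assumes "prime p" "p = 4 * m + 1"
  shows "Legendre 2 (int p) = (-1) ^ m"
proof -
  have m: "m > 0" using assms by (cases m) auto
  interpret GAUSS p 2
  proof
    show "[2 \<noteq> 0] (mod int p)"
      using assms(2) m zdvd_imp_le[of "int p" 2] by (auto simp: cong_0_iff)
  qed (use assms m in auto)
  have half: "(int p - 1) div 2 = 2 * int m" using assms(2) by simp
  have "C = (\<lambda>x. x * 2) ` A"
    unfolding C_def B_def image_image A_def using half assms(2) by (intro image_cong) auto
  then have "E = (\<lambda>x. x * 2) ` {int m<..2 * int m}"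
    unfolding E_def A_def half by (auto simp: image_iff)
  then have "card E = m"
    by (simp add: card_image inj_on_def)
  then show ?thesis using gauss_lemma by simp
qed

text \<open>With \<open>t = 2 * s + 1\<close>, the power \<open>a ^ t\<close> is \<open>a\<close>
  times the square of the unit \<open>a ^ s\<close>. Dividing a square root of \<open>a ^ t\<close>
  by that unit gives a square root of \<open>a\<close>.\<close>

lemma odd_power_QuadRes:
  assumes "QuadRes p (a ^ t)" "odd t" "prime p" "\<not> p dvd a"
  shows "QuadRes p a"
proof -
  obtain s where s: "t = 2 * s + 1" using assms(2) by (rule oddE)
  obtain y where y: "[y\<^sup>2 = a ^ t] (mod p)" using assms(1) by (auto simp: QuadRes_def)
  have "coprime (a ^ s) p"
    using assms(3,4) prime_imp_coprime[of p a] by (simp add: ac_simps)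
  then obtain z where z: "[a ^ s * z = 1] (mod p)" using cong_solve_coprime_int by blast
  have "[(y * z)\<^sup>2 = a ^ t * z\<^sup>2] (mod p)"
    unfolding power_mult_distrib by (rule cong_scalar_right[OF y])
  also have "a ^ t * z\<^sup>2 = a * (a ^ s * z)\<^sup>2"
    by (simp add: s power_add power_mult_distrib power_even_eq)
  also have "[\<dots> = a * 1\<^sup>2] (mod p)" by (intro cong_scalar_left cong_pow z)
  finally show ?thesis unfolding QuadRes_def by auto
qed

section \<open>Residue convolution and the square root bound\<close>

locale residue_prime =
  fixes p :: nat
  assumes prime_p: "prime p" and p_mod_4: "p mod 4 = 1"
begin

text \<open>Functions on Z/p are kept as periodic functions on the integers with integer values.
  Shifts and dilations of the argument then need no reduction, and one integer identity can be read
  modulo any \<open>r\<close>.\<close>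

definition periodic :: "(int \<Rightarrow> int) \<Rightarrow> bool" where
  "periodic f \<longleftrightarrow> (\<forall>k. f (k mod int p) = f k)"

definition total :: "(int \<Rightarrow> int) \<Rightarrow> int" where
  "total f = (\<Sum>i\<in>{0..<int p}. f i)"

abbreviation chi :: "int \<Rightarrow> int" where
  "chi x \<equiv> Legendre x (int p)"

definition chi_conv :: "(int \<Rightarrow> int) \<Rightarrow> int \<Rightarrow> int" where
  "chi_conv f k = (\<Sum>x\<in>{0..<int p}. chi x * f (k - x))"

text \<open>This is the operator \<open>E\<close>. Summing over the residues directly keeps it
  integral; \<open>chi_conv\<close> determines only its double, which would say too little modulo
  2.\<close>

definition res_conv :: "(int \<Rightarrow> int) \<Rightarrow> int \<Rightarrow> int" where
  "res_conv f k = (\<Sum>x\<in>{0..<int p}. (if chi x = 1 then f (k - x) else 0))"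

definition m :: int where "m = (int p - 1) div 4"

lemma p_eq: "int p = 4 * m + 1"
proof -
  have "int p mod 4 = 1" using p_mod_4 by presburger
  then show ?thesis unfolding m_def by presburger
qed

lemma p_ge_5: "p \<ge> 5"
  using prime_p p_mod_4 prime_ge_2_nat[of p] by presburger

lemma periodicD: "periodic f \<Longrightarrow> f (k mod int p) = f k"
  by (simp add: periodic_def)

lemma periodic_cong: "periodic f \<Longrightarrow> [x = y] (mod int p) \<Longrightarrow> f x = f y"
  unfolding periodic_def cong_def by metis

lemma periodicI: "(\<And>x y. [x = y] (mod int p) \<Longrightarrow> f x = f y) \<Longrightarrow> periodic f"
  unfolding periodic_def cong_def by (metis mod_mod_trivial)

lemma periodic_shift: "periodic f \<Longrightarrow> periodic (\<lambda>x. f (k - x))"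
  by (intro periodicI) (rule periodic_cong, assumption, intro cong_diff cong_refl)

lemma periodic_const: "periodic (\<lambda>_. c)"
  by (simp add: periodic_def)

lemma periodic_chi: "periodic chi"
  by (intro periodicI Legendre_cong)

lemma periodic_scale: "periodic f \<Longrightarrow> periodic (\<lambda>x. f (a * x))"
  by (intro periodicI) (rule periodic_cong, assumption, rule cong_scalar_left)

lemma periodic_op:
  assumes "periodic f" "periodic g"
  shows "periodic (\<lambda>x. h (f x) (g x))"
  by (intro periodicI) (metis assms periodic_cong)

lemma total_affine:
  assumes g: "periodic g" and a: "\<not> int p dvd a"
  shows "(\<Sum>i\<in>{0..<int p}. g (a * i + c)) = total g"
proof -
  have p0: "0 < int p" using p_ge_5 by simp
  have cop: "coprime a (int p)"
    using a prime_p prime_imp_coprime[of "int p" a] by (simp add: ac_simps)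
  have inj: "inj_on (\<lambda>i. (a * i + c) mod int p) {0..<int p}"
  proof (rule inj_onI)
    fix i j assume ij: "i \<in> {0..<int p}" "j \<in> {0..<int p}"
      and "(a * i + c) mod int p = (a * j + c) mod int p"
    then have "[a * i + c = a * j + c] (mod int p)" by (simp add: cong_def)
    then have "[a * i = a * j] (mod int p)" by (simp add: cong_add_rcancel)
    then have "[i = j] (mod int p)" using cop cong_mult_lcancel by blast
    then show "i = j" using ij cong_less_imp_eq_int by auto
  qed
  have "(\<lambda>i. (a * i + c) mod int p) ` {0..<int p} = {0..<int p}"
    using p0 by (intro endo_inj_surj inj) auto
  then have "bij_betw (\<lambda>i. (a * i + c) mod int p) {0..<int p} {0..<int p}"
    using inj by (simp add: bij_betw_def)
  then have "total g = (\<Sum>i\<in>{0..<int p}. g ((a * i + c) mod int p))"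
    unfolding total_def by (rule sum.reindex_bij_betw[symmetric])
  then show ?thesis using periodicD[OF g] by simp
qed

lemma not_dvd_one: "\<not> int p dvd 1" "\<not> int p dvd -1"
  using p_ge_5 by auto

lemma total_shift: "periodic g \<Longrightarrow> (\<Sum>i\<in>{0..<int p}. g (i + c)) = total g"
  using total_affine[of g 1 c] not_dvd_one by simp

lemma total_reflect: "periodic g \<Longrightarrow> (\<Sum>i\<in>{0..<int p}. g (c - i)) = total g"
  using total_affine[of g "-1" c] not_dvd_one by simp

section \<open>The quadratic character modulo \<open>p\<close> and its Jacobi sum\<close>

lemma chi_mult: "chi (a * b) = chi a * chi b"
  using Legendre_mult[OF prime_p] p_ge_5 by simp

lemma chi_eq_0_iff: "chi x = 0 \<longleftrightarrow> int p dvd x"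
  by (simp add: Legendre_def cong_0_iff)

lemma chi_values: "chi x = 0 \<or> chi x = 1 \<or> chi x = -1"
  by (simp add: Legendre_def)

lemma chi_square: "\<not> int p dvd x \<Longrightarrow> chi x * chi x = 1"
  using chi_eq_0_iff[of x] chi_values[of x] by auto

lemma chi_minus_one: "chi (-1) = 1"
proof -
  have "even ((p - 1) div 2)" using p_mod_4 by presburger
  then have "[chi (-1) = 1] (mod int p)"
    using euler_criterion[OF prime_p, of "-1"] p_ge_5 by simp
  then have "int p dvd chi (-1) - 1" by (simp add: cong_iff_dvd_diff)
  moreover have "\<not> int p dvd -2" "\<not> int p dvd -1"
    using p_ge_5 zdvd_imp_le[of "int p" 2] by auto
  ultimately show ?thesis using chi_values[of "-1"] by auto
qed

lemma chi_minus: "chi (- x) = chi x"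
  using chi_mult[of "-1" x] chi_minus_one by simp

text \<open>Counting: if every class were a square, then, replacing a root z by p - z where
  necessary, each of the \<open>p\<close> classes would have a root among the (p + 1) / 2 numbers
  from 0 to (p - 1) / 2.\<close>

lemma nonresidue_exists: "\<exists>n. chi n = -1"
proof (rule ccontr)
  assume none: "\<nexists>n. chi n = -1"
  have sq: "\<exists>y\<in>{0..int ((p - 1) div 2)}. [y^2 = x] (mod int p)" for x
  proof -
    have "\<exists>y. [y^2 = x] (mod int p)"
    proof (cases "int p dvd x")
      case True
      then have "[0^2 = x] (mod int p)" by (simp add: cong_sym cong_0_iff cong_sym_eq[of 0 x])
      then show ?thesis by blast
    next
      case False
      with none have "QuadRes (int p) x"
        using chi_values[of x] chi_eq_0_iff[of x] by (auto simp: Legendre_def split: if_splits)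
      then show ?thesis by (simp add: QuadRes_def)
    qed
    then obtain y where y: "[y^2 = x] (mod int p)" by blast
    define z where "z = y mod int p"
    have z: "0 \<le> z" "z < int p" "[z^2 = x] (mod int p)"
      using y p_ge_5 by (auto simp: z_def cong_def power_mod)
    have "[(int p - z)^2 = z^2] (mod int p)"
      by (simp add: cong_iff_dvd_diff power2_eq_square algebra_simps)
    then have z': "[(int p - z)^2 = x] (mod int p)" using z(3) cong_trans by blast
    have "odd p" using p_mod_4 by presburger
    then have "z \<le> int ((p - 1) div 2) \<or> int p - z \<le> int ((p - 1) div 2)"
      using z by presburger
    then show ?thesis using z z' by force
  qed
  have "{0..<int p} \<subseteq> (\<lambda>y. y^2 mod int p) ` {0..int ((p - 1) div 2)}"
  proof
    fix x assume "x \<in> {0..<int p}"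
    then show "x \<in> (\<lambda>y. y^2 mod int p) ` {0..int ((p - 1) div 2)}"
      using sq[of x] by (auto simp: cong_def image_iff)
  qed
  then have "card {0..<int p} \<le> card {0..int ((p - 1) div 2)}"
    using surj_card_le by (metis finite_atLeastAtMost_int)
  then show False using p_ge_5 by simp
qed

text \<open>Dilation by a nonresidue permutes Z/p and changes the sign of
  \<open>chi\<close>.\<close>

lemma total_chi: "total chi = 0"
proof -
  obtain n where n: "chi n = -1" using nonresidue_exists by blast
  then have "\<not> int p dvd n" using chi_eq_0_iff[of n] by simp
  then have "total chi = (\<Sum>i\<in>{0..<int p}. chi (n * i + 0))"
    by (rule total_affine[symmetric, OF periodic_chi])
  also have "\<dots> = - total chi"
    by (simp add: chi_mult n total_def sum_negf)
  finally show ?thesis by simp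
qed

text \<open>For \<open>z\<close> nonzero the substitution of z x for x shows that the sum is the
  same as for \<open>z = 1\<close>. For \<open>z = 0\<close> it is p - 1, because -1 is a residue.
  The sum over all \<open>z\<close> is zero because \<open>chi\<close> has total zero, which forces
  the common value to be -1.\<close>

lemma jacobi_sum:
  assumes "z \<in> {0..<int p}"
  shows "(\<Sum>x\<in>{0..<int p}. chi x * chi (z - x)) = (if z = 0 then int p else 0) - 1"
proof -
  define J where "J z = (\<Sum>x\<in>{0..<int p}. chi x * chi (z - x))" for z
  have p0: "{0..<int p} = insert 0 {1..<int p}" using p_ge_5 by auto
  have ndvd: "\<not> int p dvd x" if "x \<in> {1..<int p}" for x
    using that zdvd_imp_le[of "int p" x] by auto
  have J0: "J 0 = int p - 1"
  proof -
    have "J 0 = (\<Sum>x\<in>{1..<int p}. chi x * chi x)"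
      by (simp add: J_def p0 chi_minus chi_eq_0_iff)
    also have "\<dots> = (\<Sum>x\<in>{1..<int p}. 1)"
      by (intro sum.cong) (simp_all add: chi_square ndvd)
    finally show ?thesis using p_ge_5 by simp
  qed
  have J1: "J z = J 1" if "z \<in> {1..<int p}" for z
  proof -
    have per: "periodic (\<lambda>x. chi x * chi (z - x))"
      by (intro periodic_op[where h = "(*)"] periodic_chi periodic_shift)
    have "J z = (\<Sum>x\<in>{0..<int p}. chi (z * x + 0) * chi (z - (z * x + 0)))"
      using total_affine[OF per ndvd[OF that], of 0] by (simp add: J_def total_def)
    also have "\<dots> = (\<Sum>x\<in>{0..<int p}. (chi z * chi z) * (chi x * chi (1 - x)))"
    proof (rule sum.cong[OF refl])
      fix x
      have "z - z * x = z * (1 - x)" by (simp add: algebra_simps)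
      then show "chi (z * x + 0) * chi (z - (z * x + 0)) = (chi z * chi z) * (chi x * chi (1 - x))"
        by (simp add: chi_mult)
    qed
    finally show ?thesis
      by (simp add: J_def chi_square[OF ndvd[OF that]])
  qed
  have "(\<Sum>z\<in>{0..<int p}. J z) = (\<Sum>x\<in>{0..<int p}. \<Sum>z\<in>{0..<int p}. chi x * chi (z - x))"
    unfolding J_def by (rule sum.swap)
  also have "\<dots> = (\<Sum>x\<in>{0..<int p}. chi x * total chi)"
    using total_shift[OF periodic_chi, of "- x" for x] by (simp flip: sum_distrib_left)
  also have "\<dots> = 0" by (simp add: total_chi)
  finally have "J 0 + (\<Sum>z\<in>{1..<int p}. J z) = 0" by (simp add: p0)
  moreover have "(\<Sum>z\<in>{1..<int p}. J z) = (\<Sum>z\<in>{1..<int p}. J 1)"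
    by (rule sum.cong[OF refl J1])
  ultimately have "(int p - 1) + (int p - 1) * J 1 = 0" using J0 p_ge_5 by simp
  then have "(int p - 1) * (1 + J 1) = 0" by (simp add: algebra_simps)
  then have "J 1 = -1" using p_ge_5 by simp
  then show ?thesis
    using J0 J1 assms unfolding J_def p0 by auto
qed

section \<open>Associativity of convolution, and the equation \<open>E\<^sup>2 + E = m\<close> on
  functions of total zero\<close>

lemma conv_conv:
  assumes h: "periodic h" and f: "periodic f"
  shows "(\<Sum>x\<in>{0..<int p}. g x * (\<Sum>y\<in>{0..<int p}. h y * f (k - x - y)))
       = (\<Sum>z\<in>{0..<int p}. (\<Sum>x\<in>{0..<int p}. g x * h (z - x)) * f (k - z))"
proof -
  have "(\<Sum>y\<in>{0..<int p}. h y * f (k - x - y)) = (\<Sum>z\<in>{0..<int p}. h (z - x) * f (k - z))" for x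
  proof -
    have "periodic (\<lambda>y. h y * f (k - x - y))"
      by (intro periodic_op[where h = "(*)"] h periodic_shift f)
    from total_shift[OF this, of "- x"] show ?thesis
      by (simp add: total_def)
  qed
  then have "(\<Sum>x\<in>{0..<int p}. g x * (\<Sum>y\<in>{0..<int p}. h y * f (k - x - y)))
     = (\<Sum>x\<in>{0..<int p}. \<Sum>z\<in>{0..<int p}. g x * h (z - x) * f (k - z))"
    by (simp add: sum_distrib_left mult.assoc)
  also have "\<dots> = (\<Sum>z\<in>{0..<int p}. \<Sum>x\<in>{0..<int p}. g x * h (z - x) * f (k - z))"
    by (rule sum.swap)
  finally show ?thesis by (simp add: sum_distrib_right)
qed

text \<open>By associativity this is convolution with \<open>chi\<close> convolved with itself,
  which the Jacobi sum identifies as \<open>p\<close> times the unit mass at 0, minus the constant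
  1.\<close>

lemma chi_conv_chi_conv:
  assumes "periodic f"
  shows "chi_conv (chi_conv f) k = int p * f k - total f"
proof -
  have "chi_conv (chi_conv f) k = (\<Sum>z\<in>{0..<int p}. ((if z = 0 then int p else 0) - 1) * f (k - z))"
    unfolding chi_conv_def by (subst conv_conv[OF periodic_chi assms]) (simp add: jacobi_sum)
  also have "\<dots> = (\<Sum>z\<in>{0..<int p}. if z = 0 then int p * f (k - z) else 0) - (\<Sum>z\<in>{0..<int p}. f (k - z))"
    unfolding sum_subtractf[symmetric] by (intro sum.cong) (auto simp: algebra_simps)
  also have "\<dots> = int p * f k - total f"
    using p_ge_5 total_reflect[OF assms, of k] by (simp add: sum.delta)
  finally show ?thesis .
qed

text \<open>Twice the indicator of the residues is \<open>chi\<close> plus the constant 1 minus the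
  unit mass at 0.\<close>

lemma two_res_conv:
  assumes "periodic f"
  shows "2 * res_conv f k = chi_conv f k + total f - f k"
proof -
  have "2 * (if chi x = 1 then f (k - x) else 0) = chi x * f (k - x) + f (k - x) - (if x = 0 then f (k - x) else 0)"
    if "x \<in> {0..<int p}" for x
  proof -
    have "chi x = 0 \<longleftrightarrow> x = 0"
      using that zdvd_not_zless[of x "int p"] unfolding chi_eq_0_iff by (cases "x = 0") auto
    then show ?thesis using chi_values[of x] by (elim disjE) simp_all
  qed
  then have "2 * res_conv f k = (\<Sum>x\<in>{0..<int p}. chi x * f (k - x) + f (k - x) - (if x = 0 then f (k - x) else 0))"
    unfolding res_conv_def sum_distrib_left by (intro sum.cong) auto
  also have "\<dots> = chi_conv f k + (\<Sum>x\<in>{0..<int p}. f (k - x)) - f k"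
    using p_ge_5 by (simp add: sum.distrib sum_subtractf chi_conv_def sum.delta)
  finally show ?thesis using total_reflect[OF assms] by simp
qed

lemma periodic_res_conv:
  assumes "periodic f" shows "periodic (res_conv f)"
proof (rule periodicI)
  fix k l assume "[k = l] (mod int p)"
  then have "f (k - x) = f (l - x)" for x
    by (intro periodic_cong[OF assms] cong_diff cong_refl)
  then show "res_conv f k = res_conv f l" unfolding res_conv_def by (intro sum.cong if_cong refl)
qed

lemma res_conv_linear:
  "res_conv (\<lambda>k. a * f k + b * g k) k = a * res_conv f k + b * res_conv g k"
  unfolding res_conv_def sum_distrib_left sum.distrib[symmetric] by (intro sum.cong) auto

lemma chi_conv_linear:
  "chi_conv (\<lambda>k. a * f k + b * g k) k = a * chi_conv f k + b * chi_conv g k"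
  unfolding chi_conv_def sum_distrib_left sum.distrib[symmetric]
  by (intro sum.cong) (auto simp: algebra_simps)

lemma total_chi_conv:
  assumes "periodic f" shows "total (chi_conv f) = 0"
proof -
  have "total (chi_conv f) = (\<Sum>x\<in>{0..<int p}. \<Sum>k\<in>{0..<int p}. chi x * f (k - x))"
    unfolding total_def chi_conv_def by (rule sum.swap)
  also have "\<dots> = (\<Sum>x\<in>{0..<int p}. chi x * total f)"
    using total_shift[OF assms, of "- x" for x] by (simp flip: sum_distrib_left)
  also have "\<dots> = 0" using total_chi by (simp add: total_def flip: sum_distrib_right)
  finally show ?thesis .
qed

lemma total_res_conv:
  assumes "periodic f" shows "total (res_conv f) = 2 * m * total f"
proof -
  have "2 * total (res_conv f) = (\<Sum>k\<in>{0..<int p}. chi_conv f k + total f - f k)"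
    by (simp add: total_def sum_distrib_left two_res_conv[OF assms])
  also have "\<dots> = total (chi_conv f) + int p * total f - total f"
    by (simp add: sum.distrib sum_subtractf total_def)
  finally show ?thesis by (simp add: total_chi_conv[OF assms] p_eq algebra_simps)
qed

text \<open>On functions of total zero, \<open>2 E + 1\<close> is convolution with
  \<open>chi\<close>, whose square is multiplication by \<open>p = 4 m + 1\<close>. This is the
  claim multiplied by 4, and the factor cancels over the integers.\<close>

lemma res_conv_res_conv:
  assumes f: "periodic f" and "total f = 0"
  shows "res_conv (res_conv f) k = m * f k - res_conv f k"
proof -
  let ?R = "res_conv f"
  have "2 * res_conv ?R k = chi_conv ?R k - ?R k"
    using two_res_conv[OF periodic_res_conv[OF f]] total_res_conv[OF f] assms(2) by simp
  moreover have "2 * chi_conv ?R k = int p * f k - chi_conv f k"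
  proof -
    have "2 * chi_conv ?R k = chi_conv (\<lambda>k. 2 * ?R k + 0 * f k) k"
      by (subst chi_conv_linear) simp
    also have "(\<lambda>k. 2 * ?R k + 0 * f k) = (\<lambda>k. 1 * chi_conv f k + (-1) * f k)"
      using two_res_conv[OF f] assms(2) by auto
    also have "chi_conv (\<lambda>k. 1 * chi_conv f k + (-1) * f k) k = int p * f k - chi_conv f k"
      by (subst chi_conv_linear) (simp add: chi_conv_chi_conv[OF f] assms(2))
    finally show ?thesis .
  qed
  ultimately have "4 * res_conv ?R k = int p * f k - chi_conv f k - 2 * ?R k" by linarith
  also have "chi_conv f k = 2 * ?R k + f k" using two_res_conv[OF f, of k] assms(2) by simp
  finally have "4 * res_conv ?R k = 4 * (m * f k - ?R k)" by (simp add: p_eq algebra_simps)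
  then show ?thesis by simp
qed

text \<open>The kernel \<open>?e (k - y)\<close> of the convolution is symmetric in \<open>k\<close>
  and \<open>y\<close>, because -1 is a residue.\<close>

lemma res_conv_adjoint:
  assumes f: "periodic f" and g: "periodic g"
  shows "total (\<lambda>k. f k * res_conv g k) = total (\<lambda>k. res_conv f k * g k)"
proof -
  let ?e = "\<lambda>x. if chi x = 1 then 1 else 0 :: int"
  have e: "periodic ?e" by (intro periodicI) (simp add: periodic_cong[OF periodic_chi] Legendre_cong)
  have exp: "res_conv h k = (\<Sum>y\<in>{0..<int p}. ?e (k - y) * h y)" if h: "periodic h" for h k
  proof -
    have "periodic (\<lambda>y. ?e (k - y) * h y)"
      by (intro periodic_op[where h = "(*)"] h periodic_shift[OF e])
    from total_reflect[OF this, of k] show ?thesis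
      unfolding res_conv_def total_def by (simp add: if_distrib[of "\<lambda>a. a * _"] cong: if_cong)
  qed
  have "total (\<lambda>k. f k * res_conv g k) = (\<Sum>k\<in>{0..<int p}. \<Sum>y\<in>{0..<int p}. ?e (k - y) * f k * g y)"
    unfolding total_def exp[OF g] sum_distrib_left by (simp add: ac_simps)
  also have "\<dots> = (\<Sum>y\<in>{0..<int p}. \<Sum>k\<in>{0..<int p}. ?e (k - y) * f k * g y)"
    by (rule sum.swap)
  also have "\<dots> = (\<Sum>y\<in>{0..<int p}. \<Sum>k\<in>{0..<int p}. ?e (y - k) * f k * g y)"
    using chi_minus[of "k - y" for k y] by simp
  also have "\<dots> = total (\<lambda>k. res_conv f k * g k)"
    unfolding total_def exp[OF f] sum_distrib_right ..
  finally show ?thesis .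
qed

section \<open>Convolution of \<open>u\<close> with the dilated function
  \<open>\<lambda>x. w (n * x)\<close>\<close>

definition corr :: "int \<Rightarrow> (int \<Rightarrow> int) \<Rightarrow> (int \<Rightarrow> int) \<Rightarrow> int \<Rightarrow> int" where
  "corr n u w k = (\<Sum>i\<in>{0..<int p}. u i * w (n * (k - i)))"

lemma periodic_corr:
  assumes "periodic w" shows "periodic (corr n u w)"
proof (rule periodicI)
  fix k l assume "[k = l] (mod int p)"
  then have "w (n * (k - i)) = w (n * (l - i))" for i
    by (intro periodic_cong[OF assms] cong_scalar_left cong_diff cong_refl)
  then show "corr n u w k = corr n u w l"
    unfolding corr_def by (intro sum.cong arg_cong2[where f = "(*)"] refl)
qed

lemma total_corr:
  assumes w: "periodic w" and n: "\<not> int p dvd n"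
  shows "total (corr n u w) = total u * total w"
proof -
  have "total (corr n u w) = (\<Sum>i\<in>{0..<int p}. \<Sum>k\<in>{0..<int p}. u i * w (n * (k - i)))"
    unfolding total_def corr_def by (rule sum.swap)
  also have "\<dots> = (\<Sum>i\<in>{0..<int p}. u i * total w)"
  proof (rule sum.cong[OF refl])
    fix i
    show "(\<Sum>k\<in>{0..<int p}. u i * w (n * (k - i))) = u i * total w"
      using total_affine[OF w n, of "- (n * i)"] by (simp add: algebra_simps flip: sum_distrib_left)
  qed
  finally show ?thesis by (simp add: total_def sum_distrib_right)
qed

lemma res_conv_corr:
  assumes u: "periodic u" and w: "periodic w"
  shows "res_conv (corr n u w) k = corr n (res_conv u) w k"
proof -
  have "res_conv (corr n u w) k = (\<Sum>x\<in>{0..<int p}. (if chi x = 1 then 1 else 0) *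
          (\<Sum>y\<in>{0..<int p}. u y * w (n * (k - x - y))))"
    unfolding res_conv_def corr_def by (intro sum.cong) auto
  also have "\<dots> = (\<Sum>z\<in>{0..<int p}. (\<Sum>x\<in>{0..<int p}. (if chi x = 1 then 1 else 0) * u (z - x)) * w (n * (k - z)))"
    by (rule conv_conv[OF u periodic_scale[OF w]])
  also have "\<dots> = corr n (res_conv u) w k"
    unfolding res_conv_def corr_def by (intro sum.cong refl arg_cong2[where f = "(*)"]) auto
  finally show ?thesis .
qed

text \<open>The convolution with \<open>chi\<close> may be applied to the dilated factor. Undoing
  the dilation inside it brings out \<open>chi n = -1\<close>.\<close>

lemma chi_conv_corr:
  assumes w: "periodic w" and n: "chi n = -1"
  shows "chi_conv (corr n u w) k = - corr n u (chi_conv w) k"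
proof -
  have n': "\<not> int p dvd n" using n chi_eq_0_iff[of n] by simp
  have scaled: "(\<Sum>x\<in>{0..<int p}. chi x * w (n * (z - x))) = - chi_conv w (n * z)" for z
  proof -
    have "periodic (\<lambda>x. chi x * w (n * z - x))"
      by (intro periodic_op[where h = "(*)"] periodic_chi periodic_shift w)
    from total_affine[OF this n', of 0] have "chi_conv w (n * z) = - (\<Sum>x\<in>{0..<int p}. chi x * w (n * (z - x)))"
      by (simp add: total_def chi_conv_def chi_mult n right_diff_distrib sum_negf)
    then show ?thesis by simp
  qed
  have "chi_conv (corr n u w) k = (\<Sum>x\<in>{0..<int p}. \<Sum>i\<in>{0..<int p}. u i * (chi x * w (n * (k - i - x))))"
    unfolding chi_conv_def corr_def sum_distrib_left by (simp add: algebra_simps)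
  also have "\<dots> = (\<Sum>i\<in>{0..<int p}. \<Sum>x\<in>{0..<int p}. u i * (chi x * w (n * (k - i - x))))"
    by (rule sum.swap)
  also have "\<dots> = - corr n u (chi_conv w) k"
    unfolding sum_distrib_left[symmetric] scaled corr_def by (simp add: sum_negf)
  finally show ?thesis .
qed

lemma corr_linear_right:
  "corr n u (\<lambda>k. a * f k + b * g k) k = a * corr n u f k + b * corr n u g k"
  unfolding corr_def sum_distrib_left sum.distrib[symmetric]
  by (intro sum.cong) (auto simp: algebra_simps)

lemma total_scale:
  assumes "periodic w" "\<not> int p dvd n"
  shows "(\<Sum>i\<in>{0..<int p}. w (n * (k - i))) = total w"
proof -
  have "\<not> int p dvd - n" using assms(2) by simp
  from total_affine[OF assms(1) this, of "n * k"] show ?thesis by (simp add: algebra_simps)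
qed

lemma corr_const_right: "corr n u (\<lambda>_. c) k = total u * c"
  by (simp add: corr_def total_def sum_distrib_right)

text \<open>Codewords are eigenvectors plus constants. Eigenvectors have total zero modulo
  \<open>r\<close>, so of the added terms only \<open>int p * (a * b)\<close> survives
  there.\<close>

lemma corr_shift:
  assumes "periodic w" "\<not> int p dvd n"
  shows "corr n (\<lambda>k. u k + a) (\<lambda>k. w k + b) k = corr n u w k + b * total u + a * total w + int p * (a * b)"
proof -
  have "corr n (\<lambda>k. u k + a) (\<lambda>k. w k + b) k
      = corr n u w k + (\<Sum>i\<in>{0..<int p}. b * u i) + (\<Sum>i\<in>{0..<int p}. a * w (n * (k - i))) + (\<Sum>i\<in>{0..<int p}. a * b)"
    unfolding corr_def sum.distrib[symmetric] by (intro sum.cong) (auto simp: algebra_simps)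
  then show ?thesis
    by (simp add: total_def[of u] total_scale[OF assms] flip: sum_distrib_left)
qed

text \<open>Scaling by a nonresidue exchanges residues and nonresidues, so moving the residue convolution
  from one factor to the other replaces it by the nonresidue convolution.\<close>

lemma corr_res_conv:
  assumes u: "periodic u" and w: "periodic w" and n: "chi n = -1"
  shows "corr n (res_conv u) w k = total u * total w - corr n u w k - corr n u (res_conv w) k"
proof -
  have n': "\<not> int p dvd n" using n chi_eq_0_iff[of n] by simp
  have "2 * corr n (res_conv u) w k = chi_conv (corr n u w) k + total (corr n u w) - corr n u w k"
    using two_res_conv[OF periodic_corr[OF w]] res_conv_corr[OF u w] by metis
  also have "chi_conv (corr n u w) k = - corr n u (chi_conv w) k"
    by (rule chi_conv_corr[OF w n])
  also have "chi_conv w = (\<lambda>k. 1 * (2 * res_conv w k + 1 * w k) + (-1) * total w)"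
    using two_res_conv[OF w] by (auto simp: algebra_simps)
  also have "corr n u \<dots> k = 2 * corr n u (res_conv w) k + corr n u w k - total u * total w"
    by (subst corr_linear_right, subst corr_linear_right) (simp add: corr_const_right)
  finally show ?thesis by (simp add: total_corr[OF w n'])
qed

lemma corr_cong:
  assumes "\<And>k. [u k = u' k] (mod r)" "\<And>k. [w k = w' k] (mod r)"
  shows "[corr n u w k = corr n u' w' k] (mod r)"
  unfolding corr_def by (intro cong_sum cong_mult assms)

text \<open>With \<open>n'\<close> inverse to \<open>n\<close>, the sums i + n' j for i and j in
  \<open>X\<close> take at most \<open>(card X)^2 < p\<close> values, so some \<open>k\<close> is
  none of them. If i and j = n (k - i) both lay in \<open>X\<close>, then k = i + n' j would be such
  a sum.\<close>

lemma uncovered_difference: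
  assumes X: "X \<subseteq> {0..<int p}" "(card X)^2 < p" and n: "\<not> int p dvd n"
  shows "\<exists>k. \<forall>i\<in>X. n * (k - i) mod int p \<notin> X"
proof -
  have fin: "finite X" using X(1) finite_subset by blast
  have "coprime n (int p)"
    using n prime_p prime_imp_coprime[of "int p" n] by (simp add: ac_simps)
  then obtain n' where n': "[n * n' = 1] (mod int p)" using cong_solve_coprime_int by blast
  define Y where "Y = (\<lambda>(i, j). (i + n' * j) mod int p) ` (X \<times> X)"
  have "card Y \<le> card (X \<times> X)" unfolding Y_def by (rule card_image_le) (use fin in simp)
  also have "\<dots> = (card X)^2" by (simp add: card_cartesian_product power2_eq_square)
  also have "\<dots> < card {0..<int p}" using X(2) by simp
  finally have "\<not> {0..<int p} \<subseteq> Y"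
    using card_mono[of Y "{0..<int p}"] fin unfolding Y_def by auto
  then obtain k where k: "k \<in> {0..<int p}" "k \<notin> Y" by blast
  have "n * (k - i) mod int p \<notin> X" if "i \<in> X" for i
  proof
    define j where "j = n * (k - i) mod int p"
    assume "n * (k - i) mod int p \<in> X"
    then have "(i + n' * j) mod int p \<in> Y" using that by (auto simp: Y_def j_def)
    moreover have "[i + n' * j = k] (mod int p)"
    proof -
      have "[n' * j = n' * (n * (k - i))] (mod int p)"
        unfolding j_def by (intro cong_scalar_left) (simp add: cong_def)
      also have "n' * (n * (k - i)) = (n * n') * (k - i)" by simp
      also have "[\<dots> = 1 * (k - i)] (mod int p)" by (rule cong_scalar_right[OF n'])
      finally have "[i + n' * j = i + 1 * (k - i)] (mod int p)" by (intro cong_add cong_refl)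
      then show ?thesis by simp
    qed
    ultimately show False using k by (simp add: cong_def)
  qed
  then show ?thesis by blast
qed

text \<open>The pair \<open>(u, v)\<close> encodes \<open>u + v \<alpha>\<close> with \<open>\<alpha>\<^sup>2 + \<alpha> = m\<close>, and the hypotheses say that it is an
  eigenvector of the residue convolution with eigenvalue \<open>\<alpha>\<close>. The two expressions in \<open>corr\<close> below are the
  coordinates of the product of a codeword with its image under \<open>x \<mapsto> n x\<close>.\<close>

lemma square_root_bound:
  fixes r :: nat
  assumes r: "prime r" "\<not> r dvd p"
    and uv: "periodic u" "periodic v" "[total u = 0] (mod int r)" "[total v = 0] (mod int r)"
    and Eu: "\<And>k. [res_conv u k = m * v k] (mod int r)"
    and Ev: "\<And>k. [res_conv v k = u k - v k] (mod int r)"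
    and small: "(card {i\<in>{0..<int p}. \<not> (int r dvd u i + a \<and> int r dvd v i + b)})^2 < p"
  shows "int r dvd a \<and> int r dvd b"
proof -
  obtain n where n: "chi n = -1" using nonresidue_exists by blast
  have n': "\<not> int p dvd n" using n chi_eq_0_iff[of n] by simp
  define X where "X = {i\<in>{0..<int p}. \<not> (int r dvd u i + a \<and> int r dvd v i + b)}"
  obtain k where k: "\<And>i. i \<in> X \<Longrightarrow> n * (k - i) mod int p \<notin> X"
    using uncovered_difference[of X, OF _ _ n'] small unfolding X_def by blast
  \<comment> \<open>By the choice of \<open>k\<close>, in every term one of the two arguments
    \<open>i\<close> and \<open>n * (k - i)\<close> lies outside the joint support \<open>X\<close>,
    where both shifted functions vanish modulo \<open>r\<close>.\<close>
  have zero: "[corr n (\<lambda>k. f k + c) (\<lambda>k. g k + d) k = 0] (mod int r)"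
    if f: "(f, c) \<in> {(u, a), (v, b)}" and g: "(g, d) \<in> {(u, a), (v, b)}" for f g c d
  proof -
    have perg: "periodic g" using g uv by auto
    have "int r dvd (f i + c) * (g (n * (k - i)) + d)" if i: "i \<in> {0..<int p}" for i
    proof (cases "i \<in> X")
      case False
      then show ?thesis using f i by (auto simp: X_def)
    next
      case True
      define j where "j = n * (k - i) mod int p"
      have j: "j \<in> {0..<int p}" "j \<notin> X" using k[OF True] p_ge_5 by (auto simp: j_def)
      have "g (n * (k - i)) = g j" using periodicD[OF perg] by (simp add: j_def)
      moreover have "int r dvd g j + d" using j g by (auto simp: X_def)
      ultimately show ?thesis by simp
    qed
    then show ?thesis unfolding corr_def cong_0_iff by (intro dvd_sum) auto
  qed
  have expand: "[corr n f g k + int p * (c * d) = 0] (mod int r)"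
    if f: "(f, c) \<in> {(u, a), (v, b)}" and g: "(g, d) \<in> {(u, a), (v, b)}" for f g c d
  proof -
    have "periodic g" using g uv by auto
    then have "corr n (\<lambda>k. f k + c) (\<lambda>k. g k + d) k = corr n f g k + d * total f + c * total g + int p * (c * d)"
      by (rule corr_shift[OF _ n'])
    moreover have "int r dvd total f" "int r dvd total g" using f g uv by (auto simp: cong_0_iff)
    moreover have "int r dvd corr n (\<lambda>k. f k + c) (\<lambda>k. g k + d) k" using zero[OF f g] by (simp add: cong_0_iff)
    ultimately have "int r dvd (corr n f g k + d * total f + c * total g + int p * (c * d)) - d * total f - c * total g"
      by (metis dvd_diff dvd_mult)
    then show ?thesis by (simp add: cong_0_iff)
  qed
  have move: "[corr n f' g k = - corr n f g k - corr n f g' k] (mod int r)"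
    if "periodic f" "periodic g" "int r dvd total f"
      "\<And>k. [res_conv f k = f' k] (mod int r)" "\<And>k. [res_conv g k = g' k] (mod int r)" for f f' g g'
  proof -
    have "[corr n f' g k = corr n (res_conv f) g k] (mod int r)"
      by (intro corr_cong cong_refl) (simp add: that(4) cong_sym)
    also have "corr n (res_conv f) g k = total f * total g - corr n f g k - corr n f (res_conv g) k"
      by (rule corr_res_conv[OF that(1,2) n])
    also have "[\<dots> = 0 - corr n f g k - corr n f g' k] (mod int r)"
      by (intro cong_diff cong_refl corr_cong that(5)) (use that(3) in \<open>simp add: cong_0_iff\<close>)
    finally show ?thesis by simp
  qed
  have dvd: "int r dvd total u" "int r dvd total v" using uv by (auto simp: cong_0_iff)
  \<comment> \<open>Moving the residue convolution across the pairs \<open>(u, v)\<close> and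
    \<open>(v, v)\<close> gives the vanishing of both coordinates of the product for the eigenvector
    without its constants.\<close>
  have "[corr n (\<lambda>k. m * v k) v k = - corr n u v k - corr n u (\<lambda>k. u k - v k) k] (mod int r)"
    by (rule move) (fact uv dvd Eu Ev)+
  moreover have "corr n (\<lambda>k. m * v k) v k = m * corr n v v k"
    by (simp add: corr_def sum_distrib_left mult.assoc)
  moreover have "corr n w (\<lambda>k. u k - v k) k = corr n w u k - corr n w v k" for w
    by (simp add: corr_def right_diff_distrib sum_subtractf)
  moreover have "[corr n (\<lambda>k. u k - v k) v k = - corr n v v k - corr n v (\<lambda>k. u k - v k) k] (mod int r)"
    by (rule move) (fact uv dvd Eu Ev)+
  moreover have "corr n (\<lambda>k. u k - v k) v k = corr n u v k - corr n v v k"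
    by (simp add: corr_def left_diff_distrib sum_subtractf)
  ultimately have T: "int r dvd corr n u u k + m * corr n v v k"
      "int r dvd corr n u v k + corr n v u k - corr n v v k"
    by (simp_all add: cong_iff_dvd_diff algebra_simps)
  have ex: "int r dvd corr n u u k + int p * (a * a)" "int r dvd corr n u v k + int p * (a * b)"
      "int r dvd corr n v u k + int p * (b * a)" "int r dvd corr n v v k + int p * (b * b)"
    by (simp_all add: expand flip: cong_0_iff)
  have prime: "prime (int r)" using r by simp
  have rp: "\<not> int r dvd int p" using r(2) by simp
  \<comment> \<open>Comparing \<open>T\<close> with \<open>ex\<close> leaves only the constants:
    \<open>p (a + b \<alpha>)\<^sup>2\<close> vanishes, with coordinates
    \<open>a * a + m * (b * b)\<close> and \<open>b * (2 * a - b)\<close> once the unit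
    \<open>p\<close> is removed.\<close>
  have "int r dvd (corr n u u k + int p * (a * a)) + m * (corr n v v k + int p * (b * b)) - (corr n u u k + m * corr n v v k)"
    by (intro dvd_diff dvd_add dvd_mult ex T)
  then have "int r dvd int p * (a * a + m * (b * b))" by (simp add: algebra_simps)
  then have N: "int r dvd a * a + m * (b * b)" using prime_dvd_multD[OF prime] rp by blast
  have "int r dvd (corr n u v k + int p * (a * b)) + (corr n v u k + int p * (b * a)) - (corr n v v k + int p * (b * b))
      - (corr n u v k + corr n v u k - corr n v v k)"
    by (intro dvd_diff dvd_add ex T)
  then have "int r dvd int p * (b * (2 * a - b))" by (simp add: algebra_simps)
  then have "int r dvd b * (2 * a - b)" using prime_dvd_multD[OF prime] rp by blast
  \<comment> \<open>It remains to see that \<open>a + b \<alpha>\<close> cannot be a nonzero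
    nilpotent. If \<open>b = 0\<close>, then \<open>a\<^sup>2 = 0\<close>. If
    \<open>b = 2 a\<close>, then the first coordinate is
    \<open>(1 + 4 m) a\<^sup>2 = p a\<^sup>2\<close>.\<close>
  then consider "int r dvd b" | "int r dvd 2 * a - b" using prime_dvd_multD[OF prime] by blast
  then show ?thesis
  proof cases
    case 1
    then have "int r dvd (a * a + m * (b * b)) - m * (b * b)" by (intro dvd_diff N) auto
    then have "int r dvd a" using prime_dvd_multD[OF prime, of a a] by auto
    with 1 show ?thesis by blast
  next
    case 2
    have "int r dvd (a * a + m * (b * b)) + m * ((2 * a - b) * (2 * a + b))"
      by (intro dvd_add N dvd_mult dvd_mult2 2)
    also have "(a * a + m * (b * b)) + m * ((2 * a - b) * (2 * a + b)) = int p * (a * a)"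
      by (simp add: p_eq algebra_simps)
    finally have "int r dvd a" using prime_dvd_multD[OF prime] rp by blast
    then have "int r dvd 2 * a - (2 * a - b)" using dvd_diff[OF _ 2, of "2 * a"] by simp
    with \<open>int r dvd a\<close> show ?thesis by simp
  qed
qed

end

section \<open>CSS codes\<close>

lemma card_qbasis: "card (qbasis n r) = r ^ n"
proof -
  have "bij_betw (\<lambda>x. restrict x {..<n}) (qbasis n r) ({..<n} \<rightarrow>\<^sub>E {..<r})"
  proof (rule bij_betw_byWitness[where f' = "\<lambda>g i. if i < n then g i else 0"])
    show "\<forall>x\<in>qbasis n r. (\<lambda>i. if i < n then restrict x {..<n} i else 0) = x"
      by (auto simp: qbasis_def)
    show "\<forall>g\<in>{..<n} \<rightarrow>\<^sub>E {..<r}. restrict (\<lambda>i. if i < n then g i else 0) {..<n} = g"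
    proof
      fix g assume "g \<in> {..<n} \<rightarrow>\<^sub>E {..<r}"
      then have "g i = undefined" if "\<not> i < n" for i using that by (auto simp: PiE_def extensional_def)
      then show "restrict (\<lambda>i. if i < n then g i else 0) {..<n} = g" by (auto simp: restrict_def)
    qed
    show "(\<lambda>x. restrict x {..<n}) ` qbasis n r \<subseteq> {..<n} \<rightarrow>\<^sub>E {..<r}"
      by (auto simp: qbasis_def split: if_splits)
    show "(\<lambda>g i. if i < n then g i else 0) ` ({..<n} \<rightarrow>\<^sub>E {..<r}) \<subseteq> qbasis n r"
      by (auto simp: qbasis_def PiE_def Pi_def)
  qed
  then have "card (qbasis n r) = card ({..<n} \<rightarrow>\<^sub>E {..<r})" by (rule bij_betw_same_card)
  then show ?thesis by (simp add: card_PiE)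
qed

lemma finite_qbasis: "r > 0 \<Longrightarrow> finite (qbasis n r)"
  using card_qbasis[of n r] card_ge_0_finite[of "qbasis n r"] by simp

text \<open>Since \<open>F\<close> sees only the first \<open>n\<close> coordinates modulo
  \<open>r\<close>, translation by \<open>c\<close> acts as a permutation of the summation
  range.\<close>

lemma sum_qbasis_shift:
  fixes F :: "(nat \<Rightarrow> int) \<Rightarrow> complex"
  assumes r: "r > 0"
    and F: "\<And>y z. (\<And>i. i < n \<Longrightarrow> [y i = z i] (mod int r)) \<Longrightarrow> F y = F z"
  shows "(\<Sum>x\<in>qbasis n r. F (\<lambda>i. int (x i) + c i)) = (\<Sum>x\<in>qbasis n r. F (\<lambda>i. int (x i)))"
proof (rule sum.reindex_bij_witness[where
      i = "\<lambda>x i. if i < n then nat ((int (x i) - c i) mod int r) else 0" and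
      j = "\<lambda>x i. if i < n then nat ((int (x i) + c i) mod int r) else 0"])
  fix x assume x: "x \<in> qbasis n r"
  have nat_mod: "int (nat (z mod int r)) = z mod int r" "nat (z mod int r) < r" for z
    using r by (simp_all add: nat_less_iff)
  show "(\<lambda>i. if i < n then nat ((int (x i) - c i) mod int r) else 0) \<in> qbasis n r"
    "(\<lambda>i. if i < n then nat ((int (x i) + c i) mod int r) else 0) \<in> qbasis n r"
    by (auto simp: qbasis_def nat_mod)
  show "(\<lambda>i. if i < n then nat ((int (if i < n then nat ((int (x i) + c i) mod int r) else 0) - c i) mod int r) else 0) = x"
    using x by (intro ext) (auto simp: qbasis_def nat_mod mod_diff_left_eq)
  show "(\<lambda>i. if i < n then nat ((int (if i < n then nat ((int (x i) - c i) mod int r) else 0) + c i) mod int r) else 0) = x"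
    using x by (intro ext) (auto simp: qbasis_def nat_mod mod_add_left_eq)
  show "F (\<lambda>i. int (if i < n then nat ((int (x i) + c i) mod int r) else 0)) = F (\<lambda>i. int (x i) + c i)"
    by (rule F) (use r in simp)
qed

text \<open>\<open>P\<close> is membership in \<open>C\<^sub>0\<close>, as a predicate on integer
  words, and \<open>w \<kappa>\<close> represents the coset labelled \<open>\<kappa>\<close>.
  \<open>distance_X\<close> says that a word of weight below \<open>d\<close> cannot lie in the
  difference of two distinct cosets. \<open>distance_Z\<close> says that a word of such weight
  orthogonal to \<open>C\<^sub>0\<close> is also orthogonal to the representatives.\<close>

locale css_data =
  fixes r n t d :: nat and P :: "(nat \<Rightarrow> int) \<Rightarrow> bool" and w :: "(nat \<Rightarrow> nat) \<Rightarrow> nat \<Rightarrow> int"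
  assumes r_pos: "r > 0" and d_pos: "d > 0"
    and P_cong: "\<And>y z. (\<And>i. i < n \<Longrightarrow> [y i = z i] (mod int r)) \<Longrightarrow> P y \<Longrightarrow> P z"
    and P_0: "P (\<lambda>_. 0)"
    and P_diff: "\<And>y z. P y \<Longrightarrow> P z \<Longrightarrow> P (\<lambda>i. y i - z i)"
    and distance_X: "\<And>e \<kappa> \<mu>. \<kappa> \<in> qbasis t r \<Longrightarrow> \<mu> \<in> qbasis t r \<Longrightarrow>
      card {i. i < n \<and> \<not> int r dvd e i} < d \<Longrightarrow> P (\<lambda>i. e i - (w \<kappa> i - w \<mu> i)) \<Longrightarrow> \<kappa> = \<mu>"
    and distance_Z: "\<And>f \<kappa>. \<kappa> \<in> qbasis t r \<Longrightarrow> card {i. i < n \<and> \<not> int r dvd f i} < d \<Longrightarrow>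
      (\<And>c. P c \<Longrightarrow> int r dvd (\<Sum>i<n. f i * c i)) \<Longrightarrow> int r dvd (\<Sum>i<n. f i * w \<kappa> i)"
begin

section \<open>The additive character of Z/r and the coset states\<close>

definition phase :: "int \<Rightarrow> complex" where
  "phase z = cis (2 * pi * real_of_int z / real r)"

lemma phase_add: "phase (x + y) = phase x * phase y"
  by (simp add: phase_def cis_mult add_divide_distrib algebra_simps)

lemma phase_diff: "phase (x - y) = phase (- y) * phase x"
  using phase_add[of "- y" x] by simp

lemma phase_0: "phase 0 = 1"
  by (simp add: phase_def)

lemma cnj_phase: "cnj (phase z) = phase (- z)"
  by (simp add: phase_def cis_cnj)

lemma phase_eq_1_iff: "phase z = 1 \<longleftrightarrow> int r dvd z"
proof -
  have "phase z = 1 \<longleftrightarrow> (\<exists>k::int. 2 * pi * real_of_int z / real r = real_of_int (2 * k) * pi)"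
    by (simp add: phase_def cis_conv_exp exp_eq_1)
  also have "\<dots> \<longleftrightarrow> (\<exists>k::int. real_of_int z = real_of_int (int r * k))"
    using r_pos by (intro ex_cong1) (simp add: field_simps)
  also have "\<dots> \<longleftrightarrow> int r dvd z" unfolding of_int_eq_iff dvd_def ..
  finally show ?thesis .
qed

lemma phase_cong: "[x = y] (mod int r) \<Longrightarrow> phase x = phase y"
proof -
  assume "[x = y] (mod int r)"
  then have "phase (x - y) = 1" by (simp add: phase_eq_1_iff cong_iff_dvd_diff)
  then show ?thesis using phase_add[of "x - y" y] by simp
qed

lemma P_iff: "(\<And>i. i < n \<Longrightarrow> [y i = z i] (mod int r)) \<Longrightarrow> P y \<longleftrightarrow> P z"
  using P_cong[of y z] P_cong[of z y] cong_sym by blast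

lemma P_shift:
  assumes "P c" shows "P (\<lambda>i. y i + c i) \<longleftrightarrow> P y"
proof
  assume "P (\<lambda>i. y i + c i)"
  from P_diff[OF this assms] show "P y" by simp
next
  assume "P y"
  from P_diff[OF this P_diff[OF P_0 assms]] show "P (\<lambda>i. y i + c i)" by simp
qed

definition amplitude :: real where
  "amplitude = 1 / sqrt (real (card {x\<in>qbasis n r. P (\<lambda>i. int (x i))}))"

text \<open>The normalized uniform superposition over the coset of \<open>C\<^sub>0\<close>
  represented by \<open>w \<kappa>\<close>.\<close>

definition state :: "(nat \<Rightarrow> nat) \<Rightarrow> (nat \<Rightarrow> nat) \<Rightarrow> complex" where
  "state \<kappa> x = (if P (\<lambda>i. int (x i) - w \<kappa> i) then of_real amplitude else 0)"

lemma pauli_state: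
  assumes "x \<in> qbasis n r" "a \<in> qbasis n r"
  shows "pauli_X r a (pauli_Z n r b (state \<kappa>)) x =
    phase (\<Sum>i<n. int (b i) * (int (x i) - int (a i))) *
    (if P (\<lambda>i. int (x i) - int (a i) - w \<kappa> i) then of_real amplitude else 0)"
proof -
  define x' where "x' i = (x i + r - a i) mod r" for i
  have x': "[int (x' i) = int (x i) - int (a i)] (mod int r)" if "i < n" for i
  proof -
    have "a i \<le> r" using assms(2) that by (simp add: qbasis_def less_imp_le)
    then have "int (x' i) = (int (x i) - int (a i) + int r) mod int r"
      by (simp add: x'_def zmod_int of_nat_diff algebra_simps)
    then show ?thesis by (simp add: cong_def)
  qed
  have "cis (2 * pi * real (\<Sum>i<n. b i * x' i) / real r) = phase (\<Sum>i<n. int (b i) * int (x' i))"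
    by (simp add: phase_def)
  also have "\<dots> = phase (\<Sum>i<n. int (b i) * (int (x i) - int (a i)))"
    by (intro phase_cong cong_sum cong_scalar_left x') simp
  moreover have "P (\<lambda>i. int (x' i) - w \<kappa> i) \<longleftrightarrow> P (\<lambda>i. int (x i) - int (a i) - w \<kappa> i)"
    by (intro P_iff cong_diff x' cong_refl)
  ultimately show ?thesis
    unfolding pauli_X_def pauli_Z_def state_def x'_def by simp
qed

text \<open>The summand of the inner product of two damaged coset states with representatives
  \<open>v\<close> and \<open>v'\<close>, extended to integer words so that it can be
  translated.\<close>

definition overlap :: "(nat \<Rightarrow> nat) \<Rightarrow> (nat \<Rightarrow> nat) \<Rightarrow> (nat \<Rightarrow> nat) \<Rightarrow> (nat \<Rightarrow> nat) \<Rightarrow> (nat \<Rightarrow> int) \<Rightarrow> (nat \<Rightarrow> int) \<Rightarrow> (nat \<Rightarrow> int) \<Rightarrow> complex" where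
  "overlap a b a' b' v v' y =
    (if P (\<lambda>i. y i - int (a i) - v i) \<and> P (\<lambda>i. y i - int (a' i) - v' i)
     then phase (\<Sum>i<n. int (b' i) * (y i - int (a' i)) - int (b i) * (y i - int (a i))) * of_real (amplitude^2)
     else 0)"

lemma qinner_pauli_state:
  assumes "a \<in> qbasis n r" "a' \<in> qbasis n r"
  shows "qinner n r (pauli_X r a (pauli_Z n r b (state \<kappa>))) (pauli_X r a' (pauli_Z n r b' (state \<mu>)))
    = (\<Sum>x\<in>qbasis n r. overlap a b a' b' (w \<kappa>) (w \<mu>) (\<lambda>i. int (x i)))"
  unfolding qinner_def
proof (rule sum.cong[OF refl])
  fix x assume x: "x \<in> qbasis n r"
  show "cnj (pauli_X r a (pauli_Z n r b (state \<kappa>)) x) * pauli_X r a' (pauli_Z n r b' (state \<mu>)) x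
    = overlap a b a' b' (w \<kappa>) (w \<mu>) (\<lambda>i. int (x i))"
    unfolding pauli_state[OF x assms(1)] pauli_state[OF x assms(2)] overlap_def
    by (simp add: cnj_phase sum_subtractf phase_diff power2_eq_square)
qed

lemma overlap_cong:
  assumes "\<And>i. i < n \<Longrightarrow> [y i = z i] (mod int r)"
  shows "overlap a b a' b' v v' y = overlap a b a' b' v v' z"
proof -
  have "P (\<lambda>i. y i - int (a i) - v i) \<longleftrightarrow> P (\<lambda>i. z i - int (a i) - v i)" for a v
    by (intro P_iff cong_diff assms cong_refl)
  moreover have "phase (\<Sum>i<n. int (b' i) * (y i - int (a' i)) - int (b i) * (y i - int (a i)))
      = phase (\<Sum>i<n. int (b' i) * (z i - int (a' i)) - int (b i) * (z i - int (a i)))"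
    by (intro phase_cong cong_sum cong_diff cong_scalar_left assms cong_refl) simp_all
  ultimately show ?thesis by (simp add: overlap_def)
qed

lemma overlap_shift:
  assumes "\<And>i. v i = v' i + c i"
  shows "overlap a b a' b' v v (\<lambda>i. y i + c i)
       = phase (\<Sum>i<n. (int (b' i) - int (b i)) * c i) * overlap a b a' b' v' v' y"
proof -
  have "(\<lambda>i. y i + c i - int (a i) - v i) = (\<lambda>i. y i - int (a i) - v' i)" for a
    using assms by auto
  moreover have "(\<Sum>i<n. int (b' i) * (y i + c i - int (a' i)) - int (b i) * (y i + c i - int (a i)))
     = (\<Sum>i<n. (int (b' i) - int (b i)) * c i) + (\<Sum>i<n. int (b' i) * (y i - int (a' i)) - int (b i) * (y i - int (a i)))"
    unfolding sum.distrib[symmetric] by (intro sum.cong) (auto simp: algebra_simps)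
  ultimately show ?thesis by (simp add: overlap_def phase_add)
qed

lemma overlap_shift_code:
  assumes "P c"
  shows "overlap a b a' b' v v (\<lambda>i. y i + c i)
       = phase (\<Sum>i<n. (int (b' i) - int (b i)) * c i) * overlap a b a' b' v v y"
proof -
  have "P (\<lambda>i. y i + c i - int (a i) - v i) \<longleftrightarrow> P (\<lambda>i. y i - int (a i) - v i)" for a
    using P_shift[OF assms, of "\<lambda>i. y i - int (a i) - v i"] by (simp add: algebra_simps)
  moreover have "(\<Sum>i<n. int (b' i) * (y i + c i - int (a' i)) - int (b i) * (y i + c i - int (a i)))
     = (\<Sum>i<n. (int (b' i) - int (b i)) * c i) + (\<Sum>i<n. int (b' i) * (y i - int (a' i)) - int (b i) * (y i - int (a i)))"
    unfolding sum.distrib[symmetric] by (intro sum.cong) (auto simp: algebra_simps)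
  ultimately show ?thesis by (simp add: overlap_def phase_add)
qed

text \<open>The supports together have at most \<open>2 * ((d - 1) div 2)\<close> elements, which is
  at most \<open>d - 1\<close>; \<open>d > 0\<close> makes this less than \<open>d\<close>.\<close>

lemma weight_diff:
  assumes "qwt n a \<le> (d - 1) div 2" "qwt n a' \<le> (d - 1) div 2"
  shows "card {i. i < n \<and> \<not> int r dvd int (a' i) - int (a i)} < d"
proof -
  have "{i. i < n \<and> \<not> int r dvd int (a' i) - int (a i)} \<subseteq> {i. i < n \<and> a i \<noteq> 0} \<union> {i. i < n \<and> a' i \<noteq> 0}"
    by (auto intro!: Nat.gr0I)
  then have "card {i. i < n \<and> \<not> int r dvd int (a' i) - int (a i)}
      \<le> card ({i. i < n \<and> a i \<noteq> 0} \<union> {i. i < n \<and> a' i \<noteq> 0})"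
    by (intro card_mono) auto
  also have "\<dots> \<le> qwt n a + qwt n a'" unfolding qwt_def by (rule card_Un_le)
  finally show ?thesis using assms d_pos by linarith
qed

text \<open>A word in both shifted cosets would place the low-weight difference
  \<open>a' - a\<close> in the difference of two distinct cosets, against
  \<open>distance_X\<close>.\<close>

lemma overlap_distinct:
  assumes "\<kappa> \<in> qbasis t r" "\<mu> \<in> qbasis t r" "\<kappa> \<noteq> \<mu>"
    and "qwt n a \<le> (d - 1) div 2" "qwt n a' \<le> (d - 1) div 2"
  shows "overlap a b a' b' (w \<kappa>) (w \<mu>) y = 0"
proof -
  have False if "P (\<lambda>i. y i - int (a i) - w \<kappa> i)" "P (\<lambda>i. y i - int (a' i) - w \<mu> i)"
  proof -
    have "P (\<lambda>i. (int (a' i) - int (a i)) - (w \<kappa> i - w \<mu> i))"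
      using P_diff[OF that] by (simp add: algebra_simps)
    then show False using distance_X[OF assms(1,2) weight_diff[OF assms(4,5)]] assms(3) by blast
  qed
  then show ?thesis by (auto simp: overlap_def)
qed

text \<open>Translating the coset of \<open>\<kappa>\<close> onto \<open>C\<^sub>0\<close>
  multiplies the sum by the phase of the pairing of \<open>b' - b\<close> with
  \<open>w \<kappa>\<close>. If this phase is not 1, \<open>distance_Z\<close> yields a codeword
  whose pairing with \<open>b' - b\<close> has nontrivial phase; translation by it multiplies
  \<open>?V\<close> by that phase, so \<open>?V\<close> is zero and both sides agree.\<close>

lemma overlap_same:
  assumes "\<kappa> \<in> qbasis t r"
    and "qwt n b \<le> (d - 1) div 2" "qwt n b' \<le> (d - 1) div 2"
  shows "(\<Sum>x\<in>qbasis n r. overlap a b a' b' (w \<kappa>) (w \<kappa>) (\<lambda>i. int (x i)))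
       = (\<Sum>x\<in>qbasis n r. overlap a b a' b' (\<lambda>_. 0) (\<lambda>_. 0) (\<lambda>i. int (x i)))" (is "_ = ?V")
proof -
  let ?f = "\<lambda>i. int (b' i) - int (b i)"
  have "(\<Sum>x\<in>qbasis n r. overlap a b a' b' (w \<kappa>) (w \<kappa>) (\<lambda>i. int (x i)))
      = (\<Sum>x\<in>qbasis n r. overlap a b a' b' (w \<kappa>) (w \<kappa>) (\<lambda>i. int (x i) + w \<kappa> i))"
    by (rule sum_qbasis_shift[symmetric, OF r_pos overlap_cong])
  also have "\<dots> = phase (\<Sum>i<n. ?f i * w \<kappa> i) * ?V"
    unfolding sum_distrib_left by (intro sum.cong refl overlap_shift) simp
  also have "\<dots> = ?V"
  proof (cases "int r dvd (\<Sum>i<n. ?f i * w \<kappa> i)")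
    case True
    then show ?thesis by (simp add: phase_eq_1_iff[THEN iffD2])
  next
    case False
    then obtain c where c: "P c" "\<not> int r dvd (\<Sum>i<n. ?f i * c i)"
      using distance_Z[OF assms(1) weight_diff[OF assms(2,3)]] by blast
    have "?V = (\<Sum>x\<in>qbasis n r. overlap a b a' b' (\<lambda>_. 0) (\<lambda>_. 0) (\<lambda>i. int (x i) + c i))"
      by (rule sum_qbasis_shift[symmetric, OF r_pos overlap_cong])
    also have "\<dots> = phase (\<Sum>i<n. ?f i * c i) * ?V"
      unfolding sum_distrib_left by (intro sum.cong refl overlap_shift_code c)
    finally have "?V = 0 \<or> phase (\<Sum>i<n. ?f i * c i) = 1" by (rule mult_cancel_right1[THEN iffD1])
    then have "?V = 0" using c(2) phase_eq_1_iff by blast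
    then show ?thesis by simp
  qed
  finally show ?thesis .
qed

text \<open>This is the computation for the trivial error, given by the zero strings
  \<open>?z\<close>. The norm comes out as \<open>card ?C * amplitude^2\<close>.\<close>

lemma state_orthonormal:
  assumes "\<kappa> \<in> qbasis t r" "\<mu> \<in> qbasis t r"
  shows "qinner n r (state \<kappa>) (state \<mu>) = (if \<kappa> = \<mu> then 1 else 0)"
proof -
  let ?z = "\<lambda>_. 0 :: nat"
  have z: "?z \<in> qbasis n r" "qwt n ?z \<le> (d - 1) div 2"
    using r_pos by (simp_all add: qbasis_def qwt_def)
  have "pauli_X r ?z (pauli_Z n r ?z (state \<nu>)) x = state \<nu> x" if "x \<in> qbasis n r" for \<nu> x
    by (simp add: pauli_state[OF that z(1)] state_def phase_0)
  then have "qinner n r (state \<kappa>) (state \<mu>)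
      = qinner n r (pauli_X r ?z (pauli_Z n r ?z (state \<kappa>))) (pauli_X r ?z (pauli_Z n r ?z (state \<mu>)))"
    by (simp add: qinner_def)
  also have "\<dots> = (\<Sum>x\<in>qbasis n r. overlap ?z ?z ?z ?z (w \<kappa>) (w \<mu>) (\<lambda>i. int (x i)))"
    by (rule qinner_pauli_state[OF z(1) z(1)])
  also have "\<dots> = (if \<kappa> = \<mu> then 1 else 0)"
  proof (cases "\<kappa> = \<mu>")
    case False
    then show ?thesis by (simp add: overlap_distinct[OF assms False z(2) z(2)])
  next
    case True
    let ?C = "{x\<in>qbasis n r. P (\<lambda>i. int (x i))}"
    have "?z \<in> ?C" using z(1) P_0 by simp
    then have C: "card ?C > 0" using finite_qbasis[OF r_pos] by (auto simp: card_gt_0_iff)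
    have "(\<Sum>x\<in>qbasis n r. overlap ?z ?z ?z ?z (w \<kappa>) (w \<kappa>) (\<lambda>i. int (x i)))
      = (\<Sum>x\<in>qbasis n r. overlap ?z ?z ?z ?z (\<lambda>_. 0) (\<lambda>_. 0) (\<lambda>i. int (x i)))"
      by (rule overlap_same[OF assms(1) z(2) z(2)])
    also have "\<dots> = (\<Sum>x\<in>qbasis n r. if P (\<lambda>i. int (x i)) then of_real (amplitude^2) else 0)"
      by (simp add: overlap_def phase_0 cong: if_cong)
    also have "\<dots> = of_nat (card ?C) * of_real (amplitude^2)"
      using finite_qbasis[OF r_pos] by (simp add: sum.If_cases Int_def)
    also have "\<dots> = of_real (real (card ?C) * amplitude^2)" by simp
    also have "real (card ?C) * amplitude^2 = 1"
      using C by (simp add: amplitude_def power_divide)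
    finally show ?thesis using True by simp
  qed
  finally show ?thesis .
qed

lemma css_is_AQECC: "is_AQECC r n t d d"
proof -
  obtain h where h: "bij_betw h {..<r ^ t} (qbasis t r)"
    using ex_bij_betw_nat_finite[OF finite_qbasis[OF r_pos, of t]] card_qbasis[of t r]
    by (auto simp: atLeast0LessThan)
  have hin: "h i \<in> qbasis t r" if "i < r ^ t" for i using h that by (auto simp: bij_betw_def)
  have heq: "h i = h j \<longleftrightarrow> i = j" if "i < r ^ t" "j < r ^ t" for i j
    using h that by (auto simp: bij_betw_def inj_on_def)
  show ?thesis
    unfolding is_AQECC_def
  proof (intro exI[of _ "\<lambda>i. state (h i)"] conjI allI impI)
    fix i j assume "i < r ^ t" "j < r ^ t"
    then show "qinner n r (state (h i)) (state (h j)) = (if i = j then 1 else 0)"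
      by (simp add: state_orthonormal hin heq)
  next
    fix a b a' b'
    assume A: "a \<in> qbasis n r \<and> b \<in> qbasis n r \<and> a' \<in> qbasis n r \<and> b' \<in> qbasis n r \<and>
      qwt n a \<le> (d - 1) div 2 \<and> qwt n a' \<le> (d - 1) div 2 \<and>
      qwt n b \<le> (d - 1) div 2 \<and> qwt n b' \<le> (d - 1) div 2"
    show "\<exists>c. \<forall>i<r ^ t. \<forall>j<r ^ t.
       qinner n r (pauli_X r a (pauli_Z n r b (state (h i)))) (pauli_X r a' (pauli_Z n r b' (state (h j))))
       = (if i = j then c else 0)"
    proof (intro exI allI impI)
      fix i j assume ij: "i < r ^ t" "j < r ^ t"
      \<comment> \<open>The Knill-Laflamme constant is the overlap sum of \<open>C\<^sub>0\<close>
        with itself, which depends on the errors but not on the label.\<close>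
      show "qinner n r (pauli_X r a (pauli_Z n r b (state (h i)))) (pauli_X r a' (pauli_Z n r b' (state (h j))))
       = (if i = j then (\<Sum>x\<in>qbasis n r. overlap a b a' b' (\<lambda>_. 0) (\<lambda>_. 0) (\<lambda>i. int (x i))) else 0)"
      proof (cases "i = j")
        case True
        then show ?thesis using A overlap_same[OF hin[OF ij(1)]] by (simp add: qinner_pauli_state)
      next
        case False
        then have "h i \<noteq> h j" using heq ij by blast
        then show ?thesis
          using A False overlap_distinct[OF hin[OF ij(1)] hin[OF ij(2)]] by (simp add: qinner_pauli_state)
      qed
    qed
  qed
qed

end

section \<open>The quadratic residue code\<close>

context residue_prime
begin

text \<open>The discriminant of \<open>y\<^sup>2 + y - m\<close> is \<open>1 + 4 m = p\<close>. For
  \<open>r = 2\<close>, the value of \<open>Legendre_2\<close> makes \<open>m\<close> even, and 0 is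
  a root. For odd \<open>r\<close>, reciprocity makes \<open>p\<close> a square modulo
  \<open>r\<close>, and a root comes from completing the square.\<close>

lemma eigenvalue_exists:
  assumes r: "prime r" "\<not> p dvd r" and QR: "QuadRes (int p) (int r)"
  shows "\<exists>a. [a\<^sup>2 + a = m] (mod int r)"
proof (cases "r = 2")
  case True
  define m' where "m' = nat m"
  have "m \<ge> 0" using p_eq p_ge_5 by linarith
  then have m': "p = 4 * m' + 1" "m = int m'" using p_eq by (auto simp: m'_def)
  have "\<not> int p dvd int r" using r(2) by simp
  then have "Legendre 2 (int p) = 1"
    using QR True by (simp add: Legendre_def cong_0_iff)
  then have "even m'"
    using Legendre_2[OF prime_p m'(1)] by (cases "even m'") auto
  then have "[0\<^sup>2 + 0 = m] (mod int r)"
    using True m'(2) by (simp add: cong_iff_dvd_diff)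
  then show ?thesis by blast
next
  case False
  then have r2: "r > 2" using r(1) prime_ge_2_nat[of r] by linarith
  then have oddr: "odd r" using r(1) prime_odd_nat by blast
  have neq: "p \<noteq> r" using r(2) by auto
  have "even ((p - 1) div 2)" using p_mod_4 by presburger
  then have "Legendre (int p) (int r) * Legendre (int r) (int p) = 1"
    using Quadratic_Reciprocity[OF prime_p _ r(1) r2 neq] p_ge_5 by simp
  moreover have "Legendre (int r) (int p) = 1"
    using QR r(2) by (simp add: Legendre_def cong_0_iff)
  ultimately have "Legendre (int p) (int r) = 1" by simp
  then have "QuadRes (int r) (int p)" by (auto simp: Legendre_def split: if_splits)
  then obtain b where b: "[b\<^sup>2 = int p] (mod int r)" by (auto simp: QuadRes_def)
  \<comment> \<open>Adding the odd number \<open>r\<close> if necessary gives an odd square root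
    \<open>2 * a + 1\<close>, so halving takes place in the integers.\<close>
  define c where "c = (if odd b then b else b + int r)"
  have "odd c" using oddr by (simp add: c_def)
  then obtain a where a: "c = 2 * a + 1" by (rule oddE)
  have "[c = b] (mod int r)" by (simp add: c_def cong_def)
  then have "[c\<^sup>2 = int p] (mod int r)" using b cong_pow cong_trans by blast
  then have "int r dvd 4 * (a\<^sup>2 + a - m)"
    by (simp add: cong_iff_dvd_diff a p_eq power2_eq_square algebra_simps)
  moreover have "coprime (int r) 4"
  proof -
    have "coprime (int r) (2 ^ 2)" unfolding coprime_power_right_iff using oddr by simp
    then show ?thesis by simp
  qed
  ultimately have "int r dvd a\<^sup>2 + a - m" using coprime_dvd_mult_right_iff by blast
  then show ?thesis by (auto simp: cong_iff_dvd_diff)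
qed

section \<open>Words of length \<open>t * p\<close> as \<open>t\<close>-tuples of functions on
  Z/p\<close>

definition component :: "(nat \<Rightarrow> int) \<Rightarrow> nat \<Rightarrow> int \<Rightarrow> int" where
  "component y l i = y (l * p + nat (i mod int p))"

lemma periodic_component: "periodic (component y l)"
  by (simp add: periodic_def component_def)

lemma component_eq: "i \<in> {0..<int p} \<Longrightarrow> component y l i = y (l * p + nat i)"
  by (simp add: component_def)

lemma component_index_less:
  assumes "l < t" shows "l * p + nat (i mod int p) < t * p"
proof -
  have "nat (i mod int p) < p" using p_ge_5 by (simp add: nat_less_iff)
  then have "l * p + nat (i mod int p) < (l + 1) * p" by simp
  also have "\<dots> \<le> t * p" using assms by (intro mult_right_mono) auto
  finally show ?thesis .
qed

lemma component_of_fun: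
  assumes "periodic (u l)"
  shows "component (\<lambda>j. u (j div p) (int (j mod p))) l = u l"
proof
  fix i
  have "nat (i mod int p) < p" using p_ge_5 by (simp add: nat_less_iff)
  then have "(l * p + nat (i mod int p)) div p = l" "(l * p + nat (i mod int p)) mod p = nat (i mod int p)"
    by simp_all
  then show "component (\<lambda>j. u (j div p) (int (j mod p))) l i = u l i"
    using periodicD[OF assms, of i] p_ge_5 by (simp add: component_def)
qed

lemma sum_blocks:
  "(\<Sum>j<t * p. F j) = (\<Sum>l<t. \<Sum>i\<in>{0..<int p}. F (l * p + nat i))"
proof -
  have "(\<Sum>i\<in>{0..<int p}. F (l * p + nat i)) = sum F {l * p..<l * p + p}" for l
    by (rule sum.reindex_bij_witness[where i = "\<lambda>j. int (j - l * p)" and j = "\<lambda>i. l * p + nat i"])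
      (auto simp del: of_nat_diff)
  then show ?thesis by (simp add: sum.nat_group)
qed

text \<open>Each residue at which some component fails \<open>Q\<close> is the image under reduction
  modulo \<open>p\<close> of a nonzero position of \<open>y\<close>.\<close>

lemma support_card:
  assumes p: "\<And>l i. l < t \<Longrightarrow> i \<in> {0..<int p} \<Longrightarrow> \<not> Q l i \<Longrightarrow> \<not> int r dvd component y l i"
  shows "card {i\<in>{0..<int p}. \<exists>l<t. \<not> Q l i} \<le> card {j. j < t * p \<and> \<not> int r dvd y j}"
proof (rule surj_card_le[where f = "\<lambda>j. int (j mod p)"])
  show "finite {j. j < t * p \<and> \<not> int r dvd y j}" by simp
  show "{i\<in>{0..<int p}. \<exists>l<t. \<not> Q l i} \<subseteq> (\<lambda>j. int (j mod p)) ` {j. j < t * p \<and> \<not> int r dvd y j}"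
  proof
    fix i assume "i \<in> {i\<in>{0..<int p}. \<exists>l<t. \<not> Q l i}"
    then obtain l where i: "i \<in> {0..<int p}" and l: "l < t" "\<not> Q l i" by blast
    have "\<not> int r dvd y (l * p + nat (i mod int p))" using p[OF l(1) i l(2)] by (simp add: component_def)
    moreover have "i = int ((l * p + nat (i mod int p)) mod p)"
    proof -
      have "nat i < p" using i by auto
      then show ?thesis using i by simp
    qed
    ultimately show "i \<in> (\<lambda>j. int (j mod p)) ` {j. j < t * p \<and> \<not> int r dvd y j}"
      using component_index_less[OF l(1), of i] by blast
  qed
qed

text \<open>Modulo \<open>r\<close>, this is membership in \<open>C\<^sub>0\<close>.\<close>

definition eigenvector :: "nat \<Rightarrow> nat \<Rightarrow> (nat \<Rightarrow> nat \<Rightarrow> int) \<Rightarrow> (nat \<Rightarrow> int \<Rightarrow> int) \<Rightarrow> bool" where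
  "eigenvector r t M u \<longleftrightarrow> (\<forall>l<t. [total (u l) = 0] (mod int r) \<and>
     (\<forall>k. [res_conv (u l) k = (\<Sum>l'<t. M l l' * u l' k)] (mod int r)))"

text \<open>The words \<open>u + c\<close> range over \<open>C\<^sub>1\<close>. If fewer than
  \<open>\<surd>p\<close> residues carry a nonzero entry in some component, the constants vanish, so
  the word lies in \<open>C\<^sub>0\<close>.\<close>

definition has_sqrt_bound :: "nat \<Rightarrow> nat \<Rightarrow> (nat \<Rightarrow> nat \<Rightarrow> int) \<Rightarrow> bool" where
  "has_sqrt_bound r t M \<longleftrightarrow> (\<forall>u c. (\<forall>l<t. periodic (u l)) \<longrightarrow> eigenvector r t M u \<longrightarrow>
     (card {i\<in>{0..<int p}. \<exists>l<t. \<not> int r dvd u l i + c l})\<^sup>2 < p \<longrightarrow> (\<forall>l<t. int r dvd c l))"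

lemma has_sqrt_boundD:
  assumes "has_sqrt_bound r t M" "\<And>l. l < t \<Longrightarrow> periodic (u l)" "eigenvector r t M u"
    "(card {i\<in>{0..<int p}. \<exists>l<t. \<not> int r dvd u l i + c l})\<^sup>2 < p" "l < t"
  shows "int r dvd c l"
  using assms unfolding has_sqrt_bound_def by blast

lemma res_conv_const: "res_conv (\<lambda>_. c) k = 2 * m * c"
proof -
  have "chi_conv (\<lambda>_. c) k = 0"
    using total_chi by (simp add: chi_conv_def total_def flip: sum_distrib_right)
  then have "2 * res_conv (\<lambda>_. c) k = int p * c - c"
    using two_res_conv[OF periodic_const, of c k] by (simp add: total_def)
  then show ?thesis by (simp add: p_eq algebra_simps)
qed

lemma finite_residues: "finite {i\<in>{0..<int p}. Q i}"
  by (rule finite_subset[of _ "{0..<int p}"]) auto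

lemma total_linear: "total (\<lambda>k. a * f k + b * g k) = a * total f + b * total g"
  by (simp add: total_def sum.distrib sum_distrib_left)

lemma res_conv_scale: "res_conv (\<lambda>k. a * f k) k = a * res_conv f k"
  using res_conv_linear[of a f 0 "\<lambda>_. 0"] by simp

lemma total_scale_const: "total (\<lambda>k. a * f k) = a * total f"
  by (simp add: total_def sum_distrib_left)

lemma res_conv_cong:
  assumes "\<And>k. [f k = g k] (mod r)" shows "[res_conv f k = res_conv g k] (mod r)"
  unfolding res_conv_def by (intro cong_sum) (simp add: assms)

text \<open>A vector orthogonal to the code is tested against the codewords \<open>(E + 1 + M) (p \<delta> - 1)\<close> for unit
  vectors \<open>\<delta>\<close>.\<close>

lemma dual_eigenvector:
  assumes M: "\<And>l l'. l < t \<Longrightarrow> l' < t \<Longrightarrow>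
        [(\<Sum>k<t. M l k * M k l') + M l l' = (if l = l' then m else 0)] (mod int r)"
    and orth: "\<And>c. eigenvector r t M (component c) \<Longrightarrow> int r dvd (\<Sum>j<t * p. f j * c j)"
  shows "eigenvector r t (\<lambda>l l'. - (if l = l' then 1 else 0) - M l' l)
           (\<lambda>l k. int p * component f l k - total (component f l))"
  unfolding eigenvector_def
proof (intro allI impI conjI)
  fix l0 assume l0: "l0 < t"
  let ?f = "component f"
  show "[total (\<lambda>k. int p * ?f l0 k - total (?f l0)) = 0] (mod int r)"
    by (simp add: total_def sum_subtractf flip: sum_distrib_left)
  fix k0
  define \<delta> :: "int \<Rightarrow> int" where "\<delta> k = (if k mod int p = k0 mod int p then 1 else 0)" for k
  have tot_\<delta>: "total (\<lambda>k. g k * \<delta> k) = g k0" if g: "periodic g" for g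
  proof -
    have "total (\<lambda>k. g k * \<delta> k) = (\<Sum>k\<in>{0..<int p}. if k = k0 mod int p then g k else 0)"
      unfolding total_def \<delta>_def by (intro sum.cong) auto
    also have "\<dots> = g (k0 mod int p)" using p_ge_5 by (simp add: sum.delta)
    finally show ?thesis using periodicD[OF g] by simp
  qed
  \<comment> \<open>The unit mass made to have total zero; scaling by \<open>p\<close> avoids a
    division.\<close>
  define h where "h k = int p * \<delta> k - 1" for k
  have per_h: "periodic h" by (simp add: periodic_def h_def \<delta>_def)
  have tot_gh: "total (\<lambda>k. g k * h k) = int p * g k0 - total g" if g: "periodic g" for g
  proof -
    have "total (\<lambda>k. g k * h k) = int p * total (\<lambda>k. g k * \<delta> k) - total g"
      by (simp add: total_def h_def sum_subtractf sum_distrib_left algebra_simps)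
    then show ?thesis by (simp add: tot_\<delta>[OF g])
  qed
  have tot_h: "total h = 0"
    using tot_gh[OF periodic_const[of 1]] by (simp add: total_def)
  \<comment> \<open>Column \<open>l0\<close> of \<open>E + 1 + M\<close>, applied to
    \<open>h\<close>. It is an eigenvector because
    \<open>(E - M)(E + 1 + M) = (E\<^sup>2 + E) - (M\<^sup>2 + M)\<close> vanishes modulo
    \<open>r\<close> on functions of total zero.\<close>
  define u where "u l k = (if l = l0 then res_conv h k + h k else 0) + M l l0 * h k" for l k
  have per_u: "periodic (u l)" for l
  proof (rule periodicI)
    fix x y assume xy: "[x = y] (mod int p)"
    show "u l x = u l y"
      using periodic_cong[OF per_h xy] periodic_cong[OF periodic_res_conv[OF per_h] xy] by (simp add: u_def)
  qed
  define c where "c j = u (j div p) (int (j mod p))" for j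
  have component_c: "component c l = u l" for l
    unfolding c_def by (rule component_of_fun[OF per_u])
  have u_alt: "u l = (\<lambda>k. (if l = l0 then 1 else 0) * res_conv h k + ((if l = l0 then 1 else 0) + M l l0) * h k)" for l
    by (auto simp: u_def algebra_simps)
  have "eigenvector r t M (component c)"
    unfolding eigenvector_def component_c
  proof (intro allI impI conjI)
    fix l assume l: "l < t"
    show "[total (u l) = 0] (mod int r)"
      by (simp only: u_alt total_linear total_res_conv[OF per_h] tot_h) simp
    fix k
    have "res_conv (u l) k = (if l = l0 then m else 0) * h k + M l l0 * res_conv h k"
      by (simp only: u_alt res_conv_linear res_conv_res_conv[OF per_h tot_h]) (simp add: algebra_simps)
    also have "[\<dots> = ((\<Sum>l'<t. M l l' * M l' l0) + M l l0) * h k + M l l0 * res_conv h k] (mod int r)"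
      by (intro cong_add cong_scalar_right cong_refl cong_sym[OF M[OF l l0]])
    also have "((\<Sum>l'<t. M l l' * M l' l0) + M l l0) * h k + M l l0 * res_conv h k = (\<Sum>l'<t. M l l' * u l' k)"
    proof -
      have "(\<Sum>l'<t. M l l' * u l' k)
        = (\<Sum>l'<t. (if l' = l0 then M l l' * (res_conv h k + h k) else 0)) + (\<Sum>l'<t. M l l' * M l' l0 * h k)"
        unfolding sum.distrib[symmetric] by (intro sum.cong) (auto simp: u_def algebra_simps)
      then show ?thesis using l0 by (simp add: sum.delta algebra_simps flip: sum_distrib_left)
    qed
    finally show "[res_conv (u l) k = (\<Sum>l'<t. M l l' * u l' k)] (mod int r)" .
  qed
  then have dvd: "int r dvd (\<Sum>j<t * p. f j * c j)" by (rule orth)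
  \<comment> \<open>Since \<open>E\<close> is symmetric, pairing \<open>f\<close> with the codeword
    equals pairing \<open>h\<close> with \<open>g\<close>, in which \<open>M\<close> appears
    transposed.\<close>
  define g where "g k = res_conv (?f l0) k + ?f l0 k + (\<Sum>l<t. M l l0 * ?f l k)" for k
  have per_g: "periodic g"
  proof (rule periodicI)
    fix x y assume xy: "[x = y] (mod int p)"
    have "?f l x = ?f l y" for l by (rule periodic_cong[OF periodic_component xy])
    then show "g x = g y"
      using periodic_cong[OF periodic_res_conv[OF periodic_component] xy] by (simp add: g_def)
  qed
  have "(\<Sum>j<t * p. f j * c j) = (\<Sum>l<t. total (\<lambda>i. ?f l i * component c l i))"
    unfolding sum_blocks total_def by (intro sum.cong refl) (simp add: component_eq)
  also have "\<dots> = (\<Sum>l<t. (if l = l0 then total (\<lambda>i. ?f l i * (res_conv h i + h i)) else 0)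
                   + M l l0 * total (\<lambda>i. ?f l i * h i))"
    unfolding component_c total_def sum_distrib_left
    by (intro sum.cong refl) (auto simp: u_def algebra_simps sum.distrib)
  also have "\<dots> = total (\<lambda>i. ?f l0 i * (res_conv h i + h i)) + (\<Sum>l<t. M l l0 * total (\<lambda>i. ?f l i * h i))"
    using l0 by (simp add: sum.distrib sum.delta)
  also have "total (\<lambda>i. ?f l0 i * (res_conv h i + h i)) = total (\<lambda>i. ?f l0 i * res_conv h i) + total (\<lambda>i. ?f l0 i * h i)"
    by (simp add: total_def sum.distrib algebra_simps)
  also have "total (\<lambda>i. ?f l0 i * res_conv h i) = total (\<lambda>i. res_conv (?f l0) i * h i)"
    by (rule res_conv_adjoint[OF periodic_component per_h])
  also have "(\<Sum>l<t. M l l0 * total (\<lambda>i. ?f l i * h i)) = total (\<lambda>i. (\<Sum>l<t. M l l0 * ?f l i) * h i)"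
    unfolding total_def sum_distrib_left sum_distrib_right by (subst sum.swap) (simp add: mult.assoc)
  also have "total (\<lambda>i. res_conv (?f l0) i * h i) + total (\<lambda>i. ?f l0 i * h i)
     + total (\<lambda>i. (\<Sum>l<t. M l l0 * ?f l i) * h i) = total (\<lambda>i. g i * h i)"
    by (simp add: total_def g_def sum.distrib distrib_right)
  also have "\<dots> = int p * g k0 - total g" by (rule tot_gh[OF per_g])
  finally have gdvd: "int r dvd int p * g k0 - total g" using dvd by simp
  have tot_g: "total g = 2 * m * total (?f l0) + total (?f l0) + (\<Sum>l<t. M l l0 * total (?f l))"
  proof -
    have "total g = total (res_conv (?f l0)) + total (?f l0) + (\<Sum>k\<in>{0..<int p}. \<Sum>l<t. M l l0 * ?f l k)"
      by (simp add: total_def g_def sum.distrib)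
    also have "(\<Sum>k\<in>{0..<int p}. \<Sum>l<t. M l l0 * ?f l k) = (\<Sum>l<t. M l l0 * total (?f l))"
      unfolding total_def sum_distrib_left by (rule sum.swap)
    finally show ?thesis by (simp add: total_res_conv[OF periodic_component])
  qed
  have "(\<lambda>k. int p * ?f l0 k - total (?f l0)) = (\<lambda>k. int p * ?f l0 k + (-1) * total (?f l0))" by simp
  then have "res_conv (\<lambda>k. int p * ?f l0 k - total (?f l0)) k0 = int p * res_conv (?f l0) k0 - 2 * m * total (?f l0)"
    by (simp only: res_conv_linear res_conv_const)
  moreover have "(\<Sum>l'<t. (- (if l0 = l' then 1 else 0) - M l' l0) * (int p * ?f l' k0 - total (?f l')))
      = - (int p * ?f l0 k0 - total (?f l0)) - (\<Sum>l<t. M l l0 * (int p * ?f l k0 - total (?f l)))"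
  proof -
    have "(\<Sum>l'<t. (- (if l0 = l' then 1 else 0) - M l' l0) * (int p * ?f l' k0 - total (?f l')))
      = (\<Sum>l'<t. if l0 = l' then - (int p * ?f l' k0 - total (?f l')) else 0) - (\<Sum>l<t. M l l0 * (int p * ?f l k0 - total (?f l)))"
      unfolding sum_subtractf[symmetric] by (intro sum.cong) (auto simp: algebra_simps)
    then show ?thesis using l0 by simp
  qed
  moreover have "(\<Sum>l<t. M l l0 * (int p * ?f l k0 - total (?f l)))
      = int p * (\<Sum>l<t. M l l0 * ?f l k0) - (\<Sum>l<t. M l l0 * total (?f l))"
    by (simp add: sum_subtractf sum_distrib_left algebra_simps)
  \<comment> \<open>The defect of the desired eigenvector equation at \<open>k0\<close> is exactly
    the quantity that orthogonality makes divisible by \<open>r\<close>.\<close>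
  ultimately have "res_conv (\<lambda>k. int p * ?f l0 k - total (?f l0)) k0
      - (\<Sum>l'<t. (- (if l0 = l' then 1 else 0) - M l' l0) * (int p * ?f l' k0 - total (?f l')))
      = int p * g k0 - total g"
    unfolding tot_g g_def by (simp add: algebra_simps)
  then show "[res_conv (\<lambda>k. int p * ?f l0 k - total (?f l0)) k0
      = (\<Sum>l'<t. (- (if l0 = l' then 1 else 0) - M l' l0) * (int p * ?f l' k0 - total (?f l')))] (mod int r)"
    using gdvd by (simp add: cong_iff_dvd_diff)
qed

lemma eigenvector_cong:
  assumes "\<And>l k. l < t \<Longrightarrow> [u l k = v l k] (mod int r)" "eigenvector r t M u"
  shows "eigenvector r t M v"
  unfolding eigenvector_def
proof (intro allI impI conjI)
  fix l assume l: "l < t"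
  have "[total (v l) = total (u l)] (mod int r)"
    unfolding total_def by (intro cong_sum cong_sym[OF assms(1)[OF l]])
  then show "[total (v l) = 0] (mod int r)"
    using assms(2) l cong_trans unfolding eigenvector_def by blast
  fix k
  have "[res_conv (v l) k = res_conv (u l) k] (mod int r)"
    by (intro res_conv_cong cong_sym[OF assms(1)[OF l]])
  also have "[res_conv (u l) k = (\<Sum>l'<t. M l l' * u l' k)] (mod int r)"
    using assms(2) l unfolding eigenvector_def by blast
  also have "[(\<Sum>l'<t. M l l' * u l' k) = (\<Sum>l'<t. M l l' * v l' k)] (mod int r)"
    by (intro cong_sum cong_scalar_left assms(1)) simp
  finally show "[res_conv (v l) k = (\<Sum>l'<t. M l l' * v l' k)] (mod int r)" .
qed

lemma eigenvector_diff:
  assumes "eigenvector r t M u" "eigenvector r t M v"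
  shows "eigenvector r t M (\<lambda>l k. u l k - v l k)"
  unfolding eigenvector_def
proof (intro allI impI conjI)
  fix l assume l: "l < t"
  have "[total (u l) - total (v l) = 0 - 0] (mod int r)"
    using assms l unfolding eigenvector_def by (intro cong_diff) auto
  then show "[total (\<lambda>k. u l k - v l k) = 0] (mod int r)"
    by (simp add: total_def sum_subtractf)
  fix k
  have "[res_conv (u l) k - res_conv (v l) k = (\<Sum>l'<t. M l l' * u l' k) - (\<Sum>l'<t. M l l' * v l' k)] (mod int r)"
    using assms l unfolding eigenvector_def by (intro cong_diff) auto
  moreover have "res_conv (\<lambda>k. u l k - v l k) k = res_conv (u l) k - res_conv (v l) k"
    using res_conv_linear[of 1 "u l" "-1" "v l" k] by simp
  ultimately show "[res_conv (\<lambda>k. u l k - v l k) k = (\<Sum>l'<t. M l l' * (u l' k - v l' k))] (mod int r)"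
    by (simp add: right_diff_distrib sum_subtractf)
qed

text \<open>The label \<open>\<kappa>\<close> represents the coset of the word that is constantly
  \<open>\<kappa> l\<close> on block \<open>l\<close>. The bound for \<open>M\<close> gives
  \<open>distance_X\<close>, and the bound for the conjugate transpose gives
  \<open>distance_Z\<close>.\<close>

lemma is_AQECC_of_matrix:
  assumes r: "prime r" "\<not> r dvd p"
    and M: "\<And>l l'. l < t \<Longrightarrow> l' < t \<Longrightarrow>
        [(\<Sum>k<t. M l k * M k l') + M l l' = (if l = l' then m else 0)] (mod int r)"
    and bound: "has_sqrt_bound r t M"
    and dual_bound: "has_sqrt_bound r t (\<lambda>l l'. - (if l = l' then 1 else 0) - M l' l)"
    and d: "d > 0" "(d - 1)\<^sup>2 < p"
  shows "is_AQECC r (t * p) t d d"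
proof -
  have small: "N\<^sup>2 < p" if "N \<le> N'" "N' < d" for N N' :: nat
  proof -
    have "N\<^sup>2 \<le> (d - 1)\<^sup>2" using that by (intro power_mono) auto
    then show ?thesis using d(2) by linarith
  qed
  interpret css_data r "t * p" t d "\<lambda>y. eigenvector r t M (component y)" "\<lambda>\<kappa> j. int (\<kappa> (j div p))"
  proof
    show "r > 0" using r(1) prime_gt_0_nat by blast
    show "d > 0" by fact
  next
    fix y z assume "\<And>i. i < t * p \<Longrightarrow> [y i = z i] (mod int r)" and y: "eigenvector r t M (component y)"
    then have "[component y l k = component z l k] (mod int r)" if "l < t" for l k
      unfolding component_def using component_index_less[OF that] by blast
    from eigenvector_cong[OF this y] show "eigenvector r t M (component z)" by blast
  next
    have "component (\<lambda>_. 0) = (\<lambda>l k. 0)" by (simp add: component_def fun_eq_iff)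
    then show "eigenvector r t M (component (\<lambda>_. 0))"
      by (simp add: eigenvector_def total_def res_conv_def)
  next
    fix y z assume "eigenvector r t M (component y)" "eigenvector r t M (component z)"
    from eigenvector_diff[OF this] show "eigenvector r t M (component (\<lambda>i. y i - z i))"
      by (simp add: component_def[abs_def])
  next
    fix e and \<kappa> \<mu> :: "nat \<Rightarrow> nat"
    assume \<kappa>\<mu>: "\<kappa> \<in> qbasis t r" "\<mu> \<in> qbasis t r"
      and wt: "card {i. i < t * p \<and> \<not> int r dvd e i} < d"
      and eig: "eigenvector r t M (component (\<lambda>i. e i - (int (\<kappa> (i div p)) - int (\<mu> (i div p)))))"
    let ?u = "component (\<lambda>i. e i - (int (\<kappa> (i div p)) - int (\<mu> (i div p))))"
    have u: "?u l i + (int (\<kappa> l) - int (\<mu> l)) = component e l i" for l i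
    proof -
      have "nat (i mod int p) < p" using p_ge_5 by (simp add: nat_less_iff)
      then show ?thesis by (simp add: component_def)
    qed
    have "card {i\<in>{0..<int p}. \<exists>l<t. \<not> int r dvd ?u l i + (int (\<kappa> l) - int (\<mu> l))}
        \<le> card {j. j < t * p \<and> \<not> int r dvd e j}"
      unfolding u by (rule support_card)
    from has_sqrt_boundD[OF bound periodic_component eig small[OF this wt]]
    have dvd: "int r dvd int (\<kappa> l) - int (\<mu> l)" if "l < t" for l using that .
    show "\<kappa> = \<mu>"
    proof
      fix l
      show "\<kappa> l = \<mu> l"
      proof (cases "l < t")
        case True
        then have "[int (\<kappa> l) = int (\<mu> l)] (mod int r)" using dvd by (simp add: cong_iff_dvd_diff)
        then show ?thesis using True \<kappa>\<mu> by (simp add: qbasis_def cong_def)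
      next
        case False
        then show ?thesis using \<kappa>\<mu> by (simp add: qbasis_def)
      qed
    qed
  next
    fix f and \<kappa> :: "nat \<Rightarrow> nat"
    assume wt: "card {i. i < t * p \<and> \<not> int r dvd f i} < d"
      and orth: "\<And>c. eigenvector r t M (component c) \<Longrightarrow> int r dvd (\<Sum>i<t * p. f i * c i)"
    \<comment> \<open>Adding the constant \<open>total (component f l)\<close> to
      \<open>?u l\<close> gives \<open>p\<close> times the component of \<open>f\<close>, so the
      support is no larger than that of \<open>f\<close>. The bound then says that these totals
      vanish, which is orthogonality to the constant tuples.\<close>
    let ?u = "\<lambda>l k. int p * component f l k - total (component f l)"
    have eig: "eigenvector r t (\<lambda>l l'. - (if l = l' then 1 else 0) - M l' l) ?u"
      by (rule dual_eigenvector[OF M orth])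
    have per: "periodic (?u l)" for l
      by (intro periodic_op[where h = "\<lambda>x y. int p * x - y"] periodic_component periodic_const)
    have "card {i\<in>{0..<int p}. \<exists>l<t. \<not> int r dvd ?u l i + total (component f l)}
        \<le> card {j. j < t * p \<and> \<not> int r dvd f j}"
      by (rule support_card) auto
    from has_sqrt_boundD[OF dual_bound per eig small[OF this wt]]
    have dvd: "int r dvd total (component f l)" if "l < t" for l using that .
    have "(\<Sum>i<t * p. f i * int (\<kappa> (i div p))) = (\<Sum>l<t. total (component f l) * int (\<kappa> l))"
      unfolding sum_blocks total_def sum_distrib_right
      by (intro sum.cong refl) (auto simp: component_eq)
    also have "int r dvd \<dots>" by (intro dvd_sum dvd_mult2 dvd) simp
    finally show "int r dvd (\<Sum>i<t * p. f i * int (\<kappa> (i div p)))" .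
  qed
  show ?thesis by (rule css_is_AQECC)
qed

section \<open>The square root bound for scalar matrices and for companion blocks\<close>

definition diag_matrix :: "int \<Rightarrow> nat \<Rightarrow> nat \<Rightarrow> int" where
  "diag_matrix a l l' = (if l = l' then a else 0)"

lemma diag_matrix_sqrt_bound:
  assumes r: "prime r" "\<not> r dvd p" and a: "[a\<^sup>2 + a = m] (mod int r)"
  shows "has_sqrt_bound r t (diag_matrix a)"
  unfolding has_sqrt_bound_def
proof (intro allI impI)
  fix u c l
  assume per: "\<forall>l<t. periodic (u l)" and eig: "eigenvector r t (diag_matrix a) u"
    and small: "(card {i\<in>{0..<int p}. \<exists>l<t. \<not> int r dvd u l i + c l})\<^sup>2 < p" and l: "l < t"
  have "(\<Sum>l'<t. diag_matrix a l l' * u l' k) = a * u l k" for k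
    using l by (simp add: diag_matrix_def if_distrib[of "\<lambda>x. x * _"] cong: if_cong)
  then have Eu: "[res_conv (u l) k = a * u l k] (mod int r)" for k
    using eig l unfolding eigenvector_def by metis
  have tot: "[total (u l) = 0] (mod int r)" using eig l unfolding eigenvector_def by blast
  have "int r dvd (1 + a) * c l \<and> int r dvd c l"
  \<comment> \<open>The pair encodes \<open>(1 + a + \<alpha>) u\<close>. As
    \<open>(\<alpha> - a)(1 + a + \<alpha>) = 0\<close> modulo \<open>r\<close>, multiplication by
    \<open>\<alpha>\<close> acts on it as multiplication by \<open>a\<close>.\<close>
  proof (rule square_root_bound[OF r, where u = "\<lambda>k. (1 + a) * u l k" and v = "u l"])
    show "periodic (u l)" "[total (u l) = 0] (mod int r)" using per l tot by auto
    then show "periodic (\<lambda>k. (1 + a) * u l k)"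
      using periodic_op[where h = "\<lambda>x y. (1 + a) * x"] by blast
    show "[total (\<lambda>k. (1 + a) * u l k) = 0] (mod int r)"
      using tot by (simp add: total_scale_const cong_0_iff)
    show "[res_conv (u l) k = (1 + a) * u l k - u l k] (mod int r)" for k
      using Eu[of k] by (simp add: algebra_simps)
    show "[res_conv (\<lambda>k. (1 + a) * u l k) k = m * u l k] (mod int r)" for k
    proof -
      have "[(1 + a) * res_conv (u l) k = (1 + a) * (a * u l k)] (mod int r)"
        by (rule cong_scalar_left[OF Eu])
      also have "(1 + a) * (a * u l k) = (a\<^sup>2 + a) * u l k" by (simp add: power2_eq_square algebra_simps)
      also have "[\<dots> = m * u l k] (mod int r)" by (rule cong_scalar_right[OF a])
      finally show ?thesis by (simp add: res_conv_scale)
    qed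
    have "{i\<in>{0..<int p}. \<not> (int r dvd (1 + a) * u l i + (1 + a) * c l \<and> int r dvd u l i + c l)}
        \<subseteq> {i\<in>{0..<int p}. \<exists>l<t. \<not> int r dvd u l i + c l}"
      using l by (auto simp flip: distrib_left)
    then have "card {i\<in>{0..<int p}. \<not> (int r dvd (1 + a) * u l i + (1 + a) * c l \<and> int r dvd u l i + c l)}
        \<le> card {i\<in>{0..<int p}. \<exists>l<t. \<not> int r dvd u l i + c l}"
      by (rule card_mono[OF finite_residues])
    then have "(card {i\<in>{0..<int p}. \<not> (int r dvd (1 + a) * u l i + (1 + a) * c l \<and> int r dvd u l i + c l)})\<^sup>2
        \<le> (card {i\<in>{0..<int p}. \<exists>l<t. \<not> int r dvd u l i + c l})\<^sup>2" by (rule power_mono) simp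
    then show "(card {i\<in>{0..<int p}. \<not> (int r dvd (1 + a) * u l i + (1 + a) * c l \<and> int r dvd u l i + c l)})\<^sup>2 < p"
      using small by linarith
  qed
  then show "int r dvd c l" ..
qed

text \<open>Multiplication by \<open>\<alpha>\<close> on \<open>t / 2\<close> copies of the free module with basis \<open>1, \<alpha>\<close>.\<close>

definition block_matrix :: "nat \<Rightarrow> nat \<Rightarrow> int" where
  "block_matrix l l' = (if even l then (if l' = Suc l then m else 0)
     else if Suc l' = l then 1 else if l' = l then -1 else 0)"

text \<open>In coordinates,
  \<open>\<alpha> (x + y \<alpha>) = m y + (x - y) \<alpha>\<close>.\<close>

lemma block_matrix_row:
  assumes "even t" "l < t" "even l"
  shows "(\<Sum>l'<t. block_matrix l l' * x l') = m * x (Suc l)"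
    and "(\<Sum>l'<t. block_matrix (Suc l) l' * x l') = x l - x (Suc l)"
proof -
  have Suc: "Suc l < t" using assms by (metis Suc_lessI even_Suc)
  show "(\<Sum>l'<t. block_matrix l l' * x l') = m * x (Suc l)"
    using assms Suc by (simp add: block_matrix_def if_distrib[of "\<lambda>x. x * _"] cong: if_cong)
  have "(\<Sum>l'<t. block_matrix (Suc l) l' * x l')
      = (\<Sum>l'<t. if l' = l then x l' else 0) - (\<Sum>l'<t. if l' = Suc l then x l' else 0)"
    unfolding sum_subtractf[symmetric] using assms(3) by (intro sum.cong) (auto simp: block_matrix_def)
  then show "(\<Sum>l'<t. block_matrix (Suc l) l' * x l') = x l - x (Suc l)" using assms Suc by simp
qed

lemma block_matrix_column:
  assumes "even t" "l < t" "even l"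
  shows "(\<Sum>l'<t. block_matrix l' l * x l') = x (Suc l)"
    and "(\<Sum>l'<t. block_matrix l' (Suc l) * x l') = m * x l - x (Suc l)"
proof -
  have Suc: "Suc l < t" using assms by (metis Suc_lessI even_Suc)
  have "(\<Sum>l'<t. block_matrix l' l * x l') = (\<Sum>l'<t. if l' = Suc l then x l' else 0)"
    using assms(3) by (intro sum.cong) (auto simp: block_matrix_def)
  then show "(\<Sum>l'<t. block_matrix l' l * x l') = x (Suc l)" using Suc by simp
  have "(\<Sum>l'<t. block_matrix l' (Suc l) * x l')
      = (\<Sum>l'<t. if l' = l then m * x l' else 0) - (\<Sum>l'<t. if l' = Suc l then x l' else 0)"
    unfolding sum_subtractf[symmetric] using assms(3) by (intro sum.cong) (auto simp: block_matrix_def)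
  then show "(\<Sum>l'<t. block_matrix l' (Suc l) * x l') = m * x l - x (Suc l)" using assms Suc by simp
qed

lemma even_pair_cases:
  assumes "even t" "l < t"
  obtains l0 where "even l0" "l0 < t" "Suc l0 < t" "l = l0 \<or> l = Suc l0"
proof (cases "even l")
  case True
  then show ?thesis using assms that[of l] by (metis Suc_lessI even_Suc)
next
  case False
  then obtain l0 where "l = Suc l0" "even l0" by (cases l) auto
  then show ?thesis using assms that[of l0] by simp
qed

lemma block_matrix_square:
  assumes "even t" "l < t" "l' < t"
  shows "(\<Sum>k<t. block_matrix l k * block_matrix k l') + block_matrix l l' = (if l = l' then m else 0)"
proof -
  obtain l0 where l0: "even l0" "l0 < t" "l = l0 \<or> l = Suc l0"
    using even_pair_cases[OF assms(1,2)] by metis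
  note row = block_matrix_row[OF assms(1) l0(2,1), of "\<lambda>k. block_matrix k l'"]
  from l0(3) show ?thesis
  proof
    assume "l = l0"
    then show ?thesis using row(1) l0(1) by (auto simp: block_matrix_def)
  next
    assume "l = Suc l0"
    then show ?thesis using row(2) l0(1) by (auto simp: block_matrix_def)
  qed
qed

text \<open>The support of a single pair is contained in the joint support, so
  \<open>square_root_bound\<close> applies pair by pair. The second alternative treats the
  coordinates \<open>(u (Suc l), - u l)\<close>, in which the conjugate transpose of a block takes
  companion form.\<close>

lemma has_sqrt_bound_of_pairs:
  assumes r: "prime r" "\<not> r dvd p" and t: "even t"
    and pairs: "\<And>u l. eigenvector r t M u \<Longrightarrow> even l \<Longrightarrow> l < t \<Longrightarrow> Suc l < t \<Longrightarrow>
       (\<forall>k. [res_conv (u l) k = m * u (Suc l) k] (mod int r)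
            \<and> [res_conv (u (Suc l)) k = u l k - u (Suc l) k] (mod int r)) \<or>
       (\<forall>k. [res_conv (u (Suc l)) k = m * (- u l k)] (mod int r)
            \<and> [res_conv (\<lambda>k. - u l k) k = u (Suc l) k - (- u l k)] (mod int r))"
  shows "has_sqrt_bound r t M"
  unfolding has_sqrt_bound_def
proof (intro allI impI)
  fix u c l
  assume per: "\<forall>l<t. periodic (u l)" and eig: "eigenvector r t M u"
    and small: "(card {i\<in>{0..<int p}. \<exists>l<t. \<not> int r dvd u l i + c l})\<^sup>2 < p" and l: "l < t"
  obtain l0 where l0: "even l0" "l0 < t" "Suc l0 < t" "l = l0 \<or> l = Suc l0"
    using even_pair_cases[OF t l] by metis
  have tot: "[total (u l0) = 0] (mod int r)" "[total (u (Suc l0)) = 0] (mod int r)"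
    using eig l0 unfolding eigenvector_def by auto
  have sub: "(card A)\<^sup>2 < p" if "A \<subseteq> {i\<in>{0..<int p}. \<exists>l<t. \<not> int r dvd u l i + c l}" for A
  proof -
    have "card A \<le> card {i\<in>{0..<int p}. \<exists>l<t. \<not> int r dvd u l i + c l}"
      by (rule card_mono[OF finite_residues that])
    then have "(card A)\<^sup>2 \<le> (card {i\<in>{0..<int p}. \<exists>l<t. \<not> int r dvd u l i + c l})\<^sup>2" by (rule power_mono) simp
    then show ?thesis using small by linarith
  qed
  from pairs[OF eig l0(1-3)] have "int r dvd c l0 \<and> int r dvd c (Suc l0)"
  proof
    assume *: "\<forall>k. [res_conv (u l0) k = m * u (Suc l0) k] (mod int r)
            \<and> [res_conv (u (Suc l0)) k = u l0 k - u (Suc l0) k] (mod int r)"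
    show ?thesis
    proof (rule square_root_bound[OF r, where u = "u l0" and v = "u (Suc l0)"])
      show "periodic (u l0)" "periodic (u (Suc l0))" using per l0 by auto
      show "(card {i\<in>{0..<int p}. \<not> (int r dvd u l0 i + c l0 \<and> int r dvd u (Suc l0) i + c (Suc l0))})\<^sup>2 < p"
        by (intro sub) (use l0(2,3) in blast)
    qed (use * tot in blast)+
  next
    assume *: "\<forall>k. [res_conv (u (Suc l0)) k = m * (- u l0 k)] (mod int r)
            \<and> [res_conv (\<lambda>k. - u l0 k) k = u (Suc l0) k - (- u l0 k)] (mod int r)"
    have neg: "total (\<lambda>k. - u l0 k) = - total (u l0)" by (simp add: total_def sum_negf)
    have "int r dvd c (Suc l0) \<and> int r dvd - c l0"
    proof (rule square_root_bound[OF r, where u = "u (Suc l0)" and v = "\<lambda>k. - u l0 k"])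
      show "periodic (u (Suc l0))" "[total (u (Suc l0)) = 0] (mod int r)" using per l0 tot by auto
      show "periodic (\<lambda>k. - u l0 k)" using per l0 by (simp add: periodic_def)
      show "[total (\<lambda>k. - u l0 k) = 0] (mod int r)" using tot by (simp add: neg cong_0_iff)
      have neg_dvd: "int r dvd - x + - y \<longleftrightarrow> int r dvd x + y" for x y :: int
        using dvd_minus_iff[of "int r" "x + y"] by simp
      show "(card {i\<in>{0..<int p}. \<not> (int r dvd u (Suc l0) i + c (Suc l0) \<and> int r dvd - u l0 i + - c l0)})\<^sup>2 < p"
        unfolding neg_dvd by (intro sub) (use l0(2,3) in blast)
    qed (use * in blast)+
    then show ?thesis by simp
  qed
  then show "int r dvd c l" using l0(4) by auto
qed

lemma block_matrix_sqrt_bound: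
  assumes r: "prime r" "\<not> r dvd p" and t: "even t"
  shows "has_sqrt_bound r t block_matrix"
proof (rule has_sqrt_bound_of_pairs[OF r t], rule disjI1, intro allI)
  fix u l k assume eig: "eigenvector r t block_matrix u" and l: "even l" "l < t" "Suc l < t"
  have "[res_conv (u l) k = (\<Sum>l'<t. block_matrix l l' * u l' k)] (mod int r)"
    "[res_conv (u (Suc l)) k = (\<Sum>l'<t. block_matrix (Suc l) l' * u l' k)] (mod int r)"
    using eig l unfolding eigenvector_def by blast+
  then show "[res_conv (u l) k = m * u (Suc l) k] (mod int r)
            \<and> [res_conv (u (Suc l)) k = u l k - u (Suc l) k] (mod int r)"
    by (simp add: block_matrix_row[OF t l(2,1)])
qed

text \<open>On a pair \<open>(x, y)\<close> the conjugate transpose gives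
  \<open>(- x - y, - m x)\<close>. In the coordinates \<open>(y, - x)\<close> this is again
  multiplication by \<open>\<alpha>\<close>.\<close>

lemma block_matrix_dual_sqrt_bound:
  assumes r: "prime r" "\<not> r dvd p" and t: "even t"
  shows "has_sqrt_bound r t (\<lambda>l l'. - (if l = l' then 1 else 0) - block_matrix l' l)"
proof (rule has_sqrt_bound_of_pairs[OF r t], rule disjI2, intro allI)
  let ?M = "\<lambda>l l'. - (if l = l' then 1 else 0) - block_matrix l' l"
  fix u l k assume eig: "eigenvector r t ?M u" and l: "even l" "l < t" "Suc l < t"
  have row: "(\<Sum>l'<t. ?M l l' * x l') = - x l - (\<Sum>l'<t. block_matrix l' l * x l')" if "l < t" for l x
  proof -
    have "(\<Sum>l'<t. ?M l l' * x l') = (\<Sum>l'<t. if l = l' then - x l' else 0) - (\<Sum>l'<t. block_matrix l' l * x l')"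
      unfolding sum_subtractf[symmetric] by (intro sum.cong) (auto simp: algebra_simps)
    then show ?thesis using that by simp
  qed
  have E: "[res_conv (u l) k = (\<Sum>l'<t. ?M l l' * u l' k)] (mod int r)"
    "[res_conv (u (Suc l)) k = (\<Sum>l'<t. ?M (Suc l) l' * u l' k)] (mod int r)"
    using eig l unfolding eigenvector_def by blast+
  have "[- res_conv (u l) k = - (- u l k - u (Suc l) k)] (mod int r)"
    using E(1) unfolding row[OF l(2)] block_matrix_column[OF t l(2,1)] cong_minus_minus_iff .
  moreover have "res_conv (\<lambda>k. - u l k) k = - res_conv (u l) k"
    using res_conv_scale[of "-1" "u l" k] by simp
  ultimately show "[res_conv (u (Suc l)) k = m * (- u l k)] (mod int r)
            \<and> [res_conv (\<lambda>k. - u l k) k = u (Suc l) k - (- u l k)] (mod int r)"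
    using E(2) unfolding row[OF l(3)] block_matrix_column[OF t l(2,1)] by (simp add: algebra_simps)
qed

end

theorem theorem14:
  fixes p ps t :: nat
  assumes "prime p" and "p mod 4 = 1"
    and "prime ps" and "t \<ge> 1" and "\<not> p dvd ps"
    and "QuadRes (int p) (int ps ^ t)"
  shows "\<exists>dz dx. is_AQECC ps (t * p) t dz dx \<and> real dz \<ge> sqrt (real p) \<and> real dx \<ge> sqrt (real p)"
proof -
  interpret residue_prime p by unfold_locales fact+
  have psp: "\<not> ps dvd p"
    using assms(1,3,5) primes_dvd_imp_eq by blast
  \<comment> \<open>With the ceiling, \<open>d\<close> reaches the square root while
    \<open>d - 1\<close>, the largest weight to be excluded, stays strictly below it.\<close>
  define d where "d = nat \<lceil>sqrt (real p)\<rceil>"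
  have "sqrt (real p) > 0" using p_ge_5 by simp
  then have d: "d > 0" "sqrt (real p) \<le> real d" "real d < sqrt (real p) + 1"
    unfolding d_def by linarith+
  have "(real (d - 1))\<^sup>2 < (sqrt (real p))\<^sup>2" using d by (intro power_strict_mono) auto
  then have "real ((d - 1)\<^sup>2) < real p" by simp
  then have d2: "(d - 1)\<^sup>2 < p" by (simp only: of_nat_less_iff)
  have "is_AQECC ps (t * p) t d d"
  proof (cases "even t")
    case True
    show ?thesis
      by (rule is_AQECC_of_matrix[OF assms(3) psp _ block_matrix_sqrt_bound[OF assms(3) psp True]
            block_matrix_dual_sqrt_bound[OF assms(3) psp True] d(1) d2])
        (simp add: block_matrix_square[OF True])
  next
    case False
    have "\<not> int p dvd int ps" using assms(5) by simp
    then have "QuadRes (int p) (int ps)"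
      using odd_power_QuadRes[OF assms(6) False] assms(1) by simp
    then obtain a where a: "[a\<^sup>2 + a = m] (mod int ps)"
      using eigenvalue_exists[OF assms(3,5)] by blast
    \<comment> \<open>The conjugate transpose of \<open>a I\<close> is \<open>(-1 - a) I\<close>,
      and \<open>-1 - a\<close> is the conjugate root of the same quadratic.\<close>
    have conj: "(-1 - a)\<^sup>2 + (-1 - a) = a\<^sup>2 + a" by (simp add: power2_eq_square algebra_simps)
    have b: "[(-1 - a)\<^sup>2 + (-1 - a) = m] (mod int ps)" unfolding conj by (rule a)
    have dual: "(\<lambda>l l'. - (if l = l' then 1 else 0) - diag_matrix a l' l) = diag_matrix (-1 - a)"
      by (auto simp: diag_matrix_def fun_eq_iff)
    show ?thesis
    proof (rule is_AQECC_of_matrix[OF assms(3) psp _ diag_matrix_sqrt_bound[OF assms(3) psp a] _ d(1) d2])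
      show "has_sqrt_bound ps t (\<lambda>l l'. - (if l = l' then 1 else 0) - diag_matrix a l' l)"
        unfolding dual by (rule diag_matrix_sqrt_bound[OF assms(3) psp b])
      fix l l' assume l: "l < t" "l' < t"
      have "(\<Sum>k<t. diag_matrix a l k * diag_matrix a k l') = a * diag_matrix a l l'"
        using l by (simp add: diag_matrix_def if_distrib[of "\<lambda>x. x * _"] cong: if_cong)
      then show "[(\<Sum>k<t. diag_matrix a l k * diag_matrix a k l') + diag_matrix a l l' = (if l = l' then m else 0)] (mod int ps)"
        using a by (simp add: diag_matrix_def power2_eq_square)
    qed
  qed
  then show ?thesis using d(2) by blast
qed

end
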